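(* Let $\delta>0$, $q>0$ be constants and let $L(t)$, $T_m(t)$ be given functions of $t>0$. Suppose that $(x^*(y,t),S(t))$, together with the function $C(t)$, where $C(t)>0$ for $t>0$, $C(0)=0$, and with $S(0)=0$, is a solution of the following moving boundary problem for the Burgers equation: $$x^*_t=x^*_{yy}-2\delta x^*x^*_y,\quad 0<y<S(t),\ t>0,$$ $$\dot C(t)=[L(t)-T_m(t)]\,\dot S(t),\quad t>0,$$ $$\left(x^*_y-\delta x^{*2}\right)\big|_{y=S(t)}=-\frac{L(t)\dot S(t)}{\delta C(t)},\quad t>0,$$ $$x^*\big|_{y=S(t)}=\frac{T_m(t)}{\delta C(t)},\quad t>0,$$ $$x^*_y(0,t)-\delta x^{*2}(0,t)=\frac{-q\exp\left(\delta\int_{S(t)}^{0}x^*(\sigma,t)\,d\sigma\right)}{\delta C(t)},\quad t>0.$$ Then the function $\Psi$ defined by $$\Psi(x^*,t)=\frac{1}{x^*_y(y,t)},\qquad x^*=x^*(y,t),$$ satisfies the following problem: $$\frac{\partial\Psi}{\partial t}=\frac{\partial}{\partial x^*}\left(\frac{\Psi_{x^*}}{\Psi^2}\right)+2\delta,\quad X_0^*(t)<x^*<X_1^*(t),\ t>0,$$ with the conditions, for $t>0$, (i) $\displaystyle \frac{1}{\Psi(X_1^*(t),t)}-\delta {X_1^*}^2(t)=-\frac{L(t)}{\delta C(t)}\left(\Psi(X_1^*(t),t)\dot X_1^*(t)+\frac{\Psi_{x^*}(X_1^*(t),t)}{\Psi^2(X_1^*(t),t)}+2\delta X_1^*(t)\right)$,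 (ii) $\displaystyle \frac{1}{\Psi(X_0^*(t),t)}-\delta {X_0^*}^2(t)=\frac{-q\exp\left(\int_0^tH(\tau)\,d\tau\right)}{\delta C(t)}$, (iii) $\displaystyle \dot C(t)=[L(t)-T_m(t)]\left[\Psi(X_1^*(t),t)\dot X_1^*(t)+\frac{\Psi_{x^*}(X_1^*(t),t)}{\Psi^2(X_1^*(t),t)}+2\delta X_1^*(t)\right]$, where the moving boundaries $X_0^*$ and $X_1^*$ are given, for $t>0$, by $$X_0^*(t)=-\int_0^t\left(\frac{\Psi_{x^*}(X_0^*(\tau),\tau)}{\Psi^3(X_0^*(\tau),\tau)}+2\delta\frac{X_0^*(\tau)}{\Psi(X_0^*(\tau),\tau)}\right)d\tau,\qquad X_1^*(t)=\frac{T_m(t)}{\delta C(t)},$$ and $$H(t)=-\frac{T_m^3(t)}{L(t)C^2(t)}+\delta\frac{T_m(t)}{L(t)}\frac{1}{\Psi(X_1^*(t),t)}-\frac{\delta}{\Psi(X_1^*(t),t)}+\frac{T_m^2(t)}{C^2(t)}+\frac{\delta}{\Psi(X_0^*(t),t)}-\delta^2{X_0^*}^2(t).$$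
   Context: Subscripts $t$, $y$, $x^*$ denote partial derivatives and a dot denotes $d/dt$. The symbol $x^*$ denotes both the unknown function $x^*(y,t)$ in the Burgers problem and the independent space variable of $\Psi$; the two are linked by $x^*=x^*(y,t)$ for each fixed $t$.
   Formalization: Condition (ii) is asserted only when the integral of x* over (0,S(t)) tends to 0 as t→0+, and the formula for X_0* only when x*(0,t)→0; each clause fails otherwise. L(t)≠0, x*_y≠0 and classical smoothness up to the boundaries are assumed. *)

theory Defs
  imports "HOL-Analysis.Analysis"
begin

text \<open>Partial derivative in the first variable, relative to the time slice \<open>I t\<close>. At the
  endpoints of an interval \<open>I t\<close> this is the one-sided derivative, at interior points the
  ordinary one.\<close>

definition partial1 :: "(real \<Rightarrow> real set) \<Rightarrow> (real \<Rightarrow> real \<Rightarrow> real) \<Rightarrow> real \<Rightarrow> real \<Rightarrow> real" where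
  "partial1 I f y t = vector_derivative (\<lambda>z. f z t) (at y within I t)"

text \<open>Regularity of a classical solution on \<open>0 \<le> y \<le> S t\<close>, \<open>t > 0\<close>: the function and its first
  two space derivatives are continuous up to the lateral boundaries (where the boundary
  conditions are read off); the third space derivative is continuous in the interior, as
  interior parabolic regularity provides. The region does not include \<open>t = 0\<close>, where it
  degenerates to a point and the solution may be singular.\<close>

definition classical_regularity ::
    "(real \<Rightarrow> real) \<Rightarrow> (real \<Rightarrow> real \<Rightarrow> real) \<Rightarrow> bool" where
  "classical_regularity S x \<longleftrightarrow>
    (let I = (\<lambda>t. {0..S t});
         D = {(y, t). 0 < t \<and> 0 \<le> y \<and> y \<le> S t};
         D0 = {(y, t). 0 < t \<and> 0 < y \<and> y < S t};
         x_y = partial1 I x; x_yy = partial1 I x_y; x_yyy = partial1 I x_yy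
     in (\<forall>t>0. (\<lambda>y. x y t) differentiable_on {0..S t}) \<and>
        (\<forall>t>0. (\<lambda>y. x_y y t) differentiable_on {0..S t}) \<and>
        (\<forall>t>0. (\<lambda>y. x_yy y t) differentiable_on {0<..<S t}) \<and>
        continuous_on D (\<lambda>(y, t). x y t) \<and>
        continuous_on D (\<lambda>(y, t). x_y y t) \<and>
        continuous_on D (\<lambda>(y, t). x_yy y t) \<and>
        continuous_on D0 (\<lambda>(y, t). x_yyy y t))"

text \<open>The moving boundary problem for the Burgers equation; \<open>x\<close> takes the arguments \<open>y\<close>, \<open>t\<close>.
  In the last condition \<open>- integral {0..S t}\<close> is the integral from \<open>S t\<close> to \<open>0\<close>.\<close>

definition burgers_mbp_solution ::
    "real \<Rightarrow> real \<Rightarrow> (real \<Rightarrow> real) \<Rightarrow> (real \<Rightarrow> real) \<Rightarrow>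
     (real \<Rightarrow> real \<Rightarrow> real) \<Rightarrow> (real \<Rightarrow> real) \<Rightarrow> (real \<Rightarrow> real) \<Rightarrow> bool" where
  "burgers_mbp_solution \<delta> q L T\<^sub>m x S C \<longleftrightarrow>
    (let I = (\<lambda>t. {0..S t}); x_y = partial1 I x; x_yy = partial1 I x_y
     in S 0 = 0 \<and> continuous_on {0..} S \<and> (\<forall>t>0. 0 < S t \<and> S differentiable (at t)) \<and>
        C 0 = 0 \<and> continuous_on {0..} C \<and> (\<forall>t>0. 0 < C t) \<and>
        classical_regularity S x \<and>
        (\<forall>t>0. \<forall>y. 0 < y \<and> y < S t \<longrightarrow>
           ((\<lambda>s. x y s) has_real_derivative x_yy y t - 2 * \<delta> * x y t * x_y y t) (at t)) \<and>
        (\<forall>t>0. (C has_real_derivative (L t - T\<^sub>m t) * deriv S t) (at t)) \<and>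
        (\<forall>t>0. x_y (S t) t - \<delta> * (x (S t) t)\<^sup>2 = - (L t * deriv S t) / (\<delta> * C t)) \<and>
        (\<forall>t>0. x (S t) t = T\<^sub>m t / (\<delta> * C t)) \<and>
        (\<forall>t>0. x_y 0 t - \<delta> * (x 0 t)\<^sup>2 =
           - q * exp (\<delta> * (- integral {0..S t} (\<lambda>\<sigma>. x \<sigma> t))) / (\<delta> * C t)))"

end

theory Submission
  imports Defs
begin

text \<open>With \<open>p = x_y\<close>, \<open>r = x_yy\<close>, \<open>w = x_yyy\<close> and \<open>g = r - 2 \<delta> x p\<close>, every slice
  \<open>x(\<cdot>, t)\<close> is injective because \<open>p\<close> has no zero, so \<open>\<Psi>(x(y, t), t) = 1 / p(y, t)\<close> gives
  \<open>\<Psi>_x = - r / p^3\<close> and \<open>(\<Psi>_x / \<Psi>^2)_x = r^2 / p^3 - w / p^2\<close>. For fixed \<open>\<xi>\<close>, the level curve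
  \<open>x(Y(t), t) = \<xi>\<close> satisfies \<open>Y' = - g / p\<close>, and \<open>p_t = g_y\<close> by symmetry of the mixed partial
  derivatives; differentiating \<open>1 / p(Y(t), t)\<close> yields the reciprocal equation. Since
  \<open>X\<^sub>1' = p S' + g\<close> at \<open>y = S(t)\<close>, the expression \<open>V\<close> equals \<open>S'\<close>, which turns the conditions at
  \<open>S\<close> into (i) and (iii). Finally \<open>X\<^sub>0' = g(0, t)\<close>, and \<open>H\<close> is the derivative of
  \<open>- \<delta> \<integral> x dy\<close>, because \<open>g\<close> is the \<open>y\<close>-derivative of \<open>p - \<delta> x^2\<close>. The Burgers equation is
  available in the open region only; on the lateral boundaries these time derivatives are
  limits from the interior.\<close>

section \<open>Differentiation lemmas for real functions of one and two variables\<close>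

text \<open>Compactness makes the inverse of \<open>\<phi>\<close> on \<open>K\<close> continuous,
  so the difference quotient of \<open>h\<close> is the quotient of those of \<open>\<psi>\<close>
  and \<open>\<phi>\<close>, taken at a point tending to \<open>y\<close>. This is the tool for
  differentiating in the variable \<open>x\<close> by way of \<open>y\<close>, endpoints
  included.\<close>

lemma has_real_derivative_of_comp_inj_on:
  fixes \<phi> \<psi> h :: "real \<Rightarrow> real"
  assumes K: "compact K" "continuous_on K \<phi>" "inj_on \<phi> K" and y: "y \<in> K"
    and \<phi>: "(\<phi> has_real_derivative d) (at y within K)" and "d \<noteq> 0"
    and \<psi>: "(\<psi> has_real_derivative e) (at y within K)"
    and h: "\<And>z. z \<in> K \<Longrightarrow> h (\<phi> z) = \<psi> z"
  shows "(h has_real_derivative e / d) (at (\<phi> y) within \<phi> ` K)"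
proof -
  define g where "g = inv_into K \<phi>"
  have g: "g (\<phi> z) = z" if "z \<in> K" for z
    using that K(3) by (simp add: g_def)
  have "continuous_on (\<phi> ` K) g"
    using K g by (intro continuous_on_inv) auto
  then have "(g \<longlongrightarrow> y) (at (\<phi> y) within \<phi> ` K)"
    using y g by (metis continuous_on_def imageI)
  \<comment> \<open>The punctured limit requires \<open>g \<xi>\<close> to avoid \<open>y\<close>;
    it does, because \<open>\<phi> (g \<xi>) = \<xi>\<close> on the image.\<close>
  moreover have "\<forall>\<^sub>F \<xi> in at (\<phi> y) within \<phi> ` K. g \<xi> \<in> K \<and> g \<xi> \<noteq> y"
    using g by (auto simp: eventually_at_filter intro!: always_eventually)
  ultimately have flim: "filterlim g (at y within K) (at (\<phi> y) within \<phi> ` K)"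
    by (simp add: filterlim_at)
  have "((\<lambda>z. ((\<psi> z - \<psi> y) / (z - y)) / ((\<phi> z - \<phi> y) / (z - y))) \<longlongrightarrow> e / d) (at y within K)"
    using \<phi> \<psi> \<open>d \<noteq> 0\<close> by (intro tendsto_divide) (auto simp: has_field_derivative_iff)
  from filterlim_compose[OF this flim]
  have "((\<lambda>\<xi>. ((\<psi> (g \<xi>) - \<psi> y) / (g \<xi> - y)) / ((\<phi> (g \<xi>) - \<phi> y) / (g \<xi> - y))) \<longlongrightarrow> e / d)
          (at (\<phi> y) within \<phi> ` K)" .
  moreover have "\<forall>\<^sub>F \<xi> in at (\<phi> y) within \<phi> ` K.
     ((\<psi> (g \<xi>) - \<psi> y) / (g \<xi> - y)) / ((\<phi> (g \<xi>) - \<phi> y) / (g \<xi> - y)) =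
     (h \<xi> - h (\<phi> y)) / (\<xi> - \<phi> y)"
    unfolding eventually_at_filter by (rule always_eventually) (use y in \<open>auto simp: g h\<close>)
  ultimately show ?thesis
    unfolding has_field_derivative_iff by (rule Lim_transform_eventually)
qed

lemma MVT_within:
  fixes f :: "real \<Rightarrow> real"
  assumes "a < b" and "\<And>x. a \<le> x \<Longrightarrow> x \<le> b \<Longrightarrow> (f has_real_derivative f' x) (at x within T)"
    and "{a..b} \<subseteq> T"
  obtains z where "a < z" "z < b" "f b - f a = f' z * (b - a)"
proof -
  have "(f has_derivative (*) (f' x)) (at x within {a..b})" if "a \<le> x" "x \<le> b" for x
    using assms(2)[OF that] assms(3) DERIV_subset unfolding has_field_derivative_def[symmetric] by blast
  from mvt_simple[OF \<open>a < b\<close> this] show ?thesis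
    using that by auto
qed

lemma MVT_segment:
  fixes f :: "real \<Rightarrow> real"
  assumes "\<And>x. x \<in> closed_segment a b \<Longrightarrow> (f has_real_derivative f' x) (at x)"
  obtains z where "z \<in> closed_segment a b" "f b - f a = f' z * (b - a)"
proof (cases a b rule: linorder_cases)
  case less
  then show ?thesis
    using MVT_within[of a b f f' UNIV] assms that
    by (simp add: closed_segment_eq_real_ivl) (metis less_imp_le)
next
  case equal
  then show ?thesis using that[of a] by simp
next
  case greater
  then obtain z where "b < z" "z < a" "f a - f b = f' z * (a - b)"
    using MVT_within[of b a f f' UNIV] assms by (auto simp: closed_segment_eq_real_ivl)
  then show ?thesis
    using that[of z] greater by (simp add: closed_segment_eq_real_ivl algebra_simps)
qed

text \<open>A Schwarz argument: two uses of the mean value theorem turn the mixed second difference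
  quotient of \<open>f\<close> into a value of \<open>f\<^sub>y\<^sub>t\<close> at a nearby point.
  Letting \<open>z\<close> tend to \<open>y\<close> first yields the difference quotient of
  \<open>p\<close>, so the differentiability of \<open>p\<close> in time is a conclusion.\<close>

lemma has_real_derivative_mixed_partial:
  fixes f g f\<^sub>y\<^sub>t :: "real \<Rightarrow> real \<Rightarrow> real"
  assumes "e > 0"
    and f_t: "\<And>z s. \<bar>z - y\<bar> < e \<Longrightarrow> \<bar>s - t\<bar> < e \<Longrightarrow> ((\<lambda>s. f z s) has_real_derivative g z s) (at s)"
    and f_y: "\<And>s. \<bar>s - t\<bar> < e \<Longrightarrow> ((\<lambda>z. f z s) has_real_derivative p s) (at y)"
    and g_y: "\<And>z s. \<bar>z - y\<bar> < e \<Longrightarrow> \<bar>s - t\<bar> < e \<Longrightarrow> ((\<lambda>z. g z s) has_real_derivative f\<^sub>y\<^sub>t z s) (at z)"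
    and cont: "continuous (at (y, t)) (\<lambda>(z, s). f\<^sub>y\<^sub>t z s)"
  shows "(p has_real_derivative f\<^sub>y\<^sub>t y t) (at t)"
  unfolding has_field_derivative_iff
proof (rule LIM_I)
  fix r :: real assume "r > 0"
  then obtain d where d: "d > 0" and
    cd: "\<And>z s. dist (z, s) (y, t) < d \<Longrightarrow> dist (f\<^sub>y\<^sub>t z s) (f\<^sub>y\<^sub>t y t) < r / 2"
    using cont unfolding continuous_at_eps_delta by (force dest: spec[of _ "r / 2"])
  \<comment> \<open>Half of \<open>d\<close> appears because a distance in the plane is at most the
    sum of the two coordinate distances.\<close>
  define k where "k = min e (d / 2)"
  have k: "k > 0" "k \<le> e" using \<open>e > 0\<close> d by (auto simp: k_def)
  have near: "\<bar>f\<^sub>y\<^sub>t z s - f\<^sub>y\<^sub>t y t\<bar> < r / 2" if "\<bar>z - y\<bar> < k" "\<bar>s - t\<bar> < k" for z s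
  proof -
    have "dist (z, s) (y, t) \<le> \<bar>z - y\<bar> + \<bar>s - t\<bar>"
      by (simp add: dist_Pair_Pair dist_real_def sqrt_sum_squares_le_sum_abs)
    then show ?thesis using cd[of z s] that by (simp add: k_def dist_real_def)
  qed
  have "\<bar>(p s - p t) / (s - t) - f\<^sub>y\<^sub>t y t\<bar> \<le> r / 2" if s: "s \<noteq> t" "\<bar>s - t\<bar> < k" for s
  proof -
    \<comment> \<open>With \<open>s\<close> fixed, \<open>z\<close> tends to \<open>y\<close>; the
      bound \<open>r / 2\<close> passes to the limit as a weak inequality and still gives a strict
      bound by \<open>r\<close>.\<close>
    have "((\<lambda>z. \<bar>((f z s - f y s) / (z - y) - (f z t - f y t) / (z - y)) / (s - t) - f\<^sub>y\<^sub>t y t\<bar>)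
             \<longlongrightarrow> \<bar>(p s - p t) / (s - t) - f\<^sub>y\<^sub>t y t\<bar>) (at y)"
      using f_y[of s] f_y[of t] s k
      by (intro tendsto_intros) (auto simp: has_field_derivative_iff)
    moreover have "\<forall>\<^sub>F z in at y.
      \<bar>((f z s - f y s) / (z - y) - (f z t - f y t) / (z - y)) / (s - t) - f\<^sub>y\<^sub>t y t\<bar> \<le> r / 2"
    proof -
      have "\<forall>\<^sub>F z in at y. \<bar>z - y\<bar> < k \<and> z \<noteq> y"
        using k(1) by (auto simp: eventually_at dist_real_def)
      then show ?thesis
      proof (rule eventually_mono)
        fix z assume z: "\<bar>z - y\<bar> < k \<and> z \<noteq> y"
        have in_seg: "\<bar>\<theta> - t\<bar> < k" if "\<theta> \<in> closed_segment t s" for \<theta>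
          using that s(2) by (auto simp: closed_segment_eq_real_ivl split: if_splits)
        \<comment> \<open>The mean value theorem acts first in time on the difference of
          \<open>f\<close> at \<open>z\<close> and \<open>y\<close>, then in space on
          \<open>g\<close> at the intermediate time.\<close>
        have "((\<lambda>\<theta>. f z \<theta> - f y \<theta>) has_real_derivative (g z \<theta> - g y \<theta>)) (at \<theta>)"
          if "\<theta> \<in> closed_segment t s" for \<theta>
          using in_seg[OF that] z k by (intro DERIV_diff f_t) auto
        then obtain \<theta> where \<theta>: "\<theta> \<in> closed_segment t s"
          "(f z s - f y s) - (f z t - f y t) = (g z \<theta> - g y \<theta>) * (s - t)"
          by (rule MVT_segment)
        have in_seg': "\<bar>\<eta> - y\<bar> < k" if "\<eta> \<in> closed_segment y z" for \<eta>
          using that z by (auto simp: closed_segment_eq_real_ivl split: if_splits)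
        have "((\<lambda>\<eta>. g \<eta> \<theta>) has_real_derivative f\<^sub>y\<^sub>t \<eta> \<theta>) (at \<eta>)"
          if "\<eta> \<in> closed_segment y z" for \<eta>
          using in_seg[OF \<theta>(1)] in_seg'[OF that] k by (intro g_y) auto
        then obtain \<eta> where \<eta>: "\<eta> \<in> closed_segment y z"
          "g z \<theta> - g y \<theta> = f\<^sub>y\<^sub>t \<eta> \<theta> * (z - y)"
          by (rule MVT_segment)
        have "((f z s - f y s) / (z - y) - (f z t - f y t) / (z - y)) / (s - t)
          = ((f z s - f y s) - (f z t - f y t)) / (z - y) / (s - t)"
          by (simp only: diff_divide_distrib)
        also have "\<dots> = f\<^sub>y\<^sub>t \<eta> \<theta>"
          using \<theta>(2) \<eta>(2) z s by simp
        finally show "\<bar>((f z s - f y s) / (z - y) - (f z t - f y t) / (z - y)) / (s - t) - f\<^sub>y\<^sub>t y t\<bar> \<le> r / 2"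
          using near[OF in_seg'[OF \<eta>(1)] in_seg[OF \<theta>(1)]] by simp
      qed
    qed
    ultimately show ?thesis
      by (rule tendsto_upperbound) simp
  qed
  then show "\<exists>k>0. \<forall>s. s \<noteq> t \<and> norm (s - t) < k \<longrightarrow> norm ((p s - p t) / (s - t) - f\<^sub>y\<^sub>t y t) < r"
    using k(1) \<open>r > 0\<close> by (intro exI[of _ k]) (force simp: )
qed

text \<open>The increment is split along the path \<open>(b t, t) \<rightarrow> (m, t) \<rightarrow> (m, s) \<rightarrow> (b s, s)\<close>
  with \<open>m = b t - k \<bar>s - t\<bar>\<close>. For \<open>k > \<bar>b'\<bar>\<close> the middle piece stays strictly inside the
  region, so no time derivative of \<open>f\<close> on the curve itself is needed.\<close>

lemma has_real_derivative_along_boundary: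
  fixes f f\<^sub>y f\<^sub>t :: "real \<Rightarrow> real \<Rightarrow> real" and b :: "real \<Rightarrow> real"
  defines "N e t \<equiv> {(y, s). \<bar>s - t\<bar> < e \<and> b t - e < y \<and> y \<le> b s}"
  assumes b: "(b has_real_derivative b') (at t)" and "e > 0"
    and f_y: "\<And>y s. (y, s) \<in> N e t \<Longrightarrow>
        ((\<lambda>y. f y s) has_real_derivative f\<^sub>y y s) (at y within {b t - e<..b s})"
    and f_t: "\<And>y s. (y, s) \<in> N e t \<Longrightarrow> y < b s \<Longrightarrow>
        ((\<lambda>s. f y s) has_real_derivative f\<^sub>t y s) (at s)"
    and cont_y: "continuous (at (b t, t) within N e t) (\<lambda>(y, s). f\<^sub>y y s)"
    and cont_t: "continuous (at (b t, t) within N e t) (\<lambda>(y, s). f\<^sub>t y s)"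
  shows "((\<lambda>s. f (b s) s) has_real_derivative f\<^sub>y (b t) t * b' + f\<^sub>t (b t) t) (at t)"
  unfolding has_field_derivative_iff
proof (rule LIM_I)
  fix r :: real assume "r > 0"
  \<comment> \<open>With \<open>\<epsilon> \<le> 1 / 2\<close>, the curve moves by at most
    \<open>k - 1 / 2\<close> times the time step, which leaves half a time step as margin to
    \<open>m\<close>. \<open>M\<close> dominates the sum of the coefficients \<open>2 * k\<close>,
    \<open>1\<close>, \<open>k\<close> and \<open>\<bar>f\<^sub>y (b t) t\<bar>\<close> in the final
    error bound.\<close>
  define k where "k = \<bar>b'\<bar> + 1"
  define M where "M = 3 * k + 2 + \<bar>f\<^sub>y (b t) t\<bar>"
  define \<epsilon> where "\<epsilon> = min (1 / 2) (r / (2 * M))"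
  have k: "k \<ge> 1" and M: "M \<ge> 5" by (auto simp: k_def M_def)
  have \<epsilon>: "\<epsilon> > 0" "\<epsilon> \<le> 1 / 2" "\<epsilon> * M < r"
  proof -
    show "\<epsilon> > 0" "\<epsilon> \<le> 1 / 2" using \<open>r > 0\<close> M by (auto simp: \<epsilon>_def)
    have "\<epsilon> * M \<le> r / (2 * M) * M" using M by (intro mult_right_mono) (auto simp: \<epsilon>_def)
    also have "\<dots> < r" using M \<open>r > 0\<close> by (simp add: field_simps)
    finally show "\<epsilon> * M < r" .
  qed
  obtain d1 where d1: "d1 > 0" "\<And>z. z \<in> N e t \<Longrightarrow> dist z (b t, t) < d1 \<Longrightarrow>
      dist (case z of (y, s) \<Rightarrow> f\<^sub>y y s) (f\<^sub>y (b t) t) < \<epsilon>"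
    using cont_y \<epsilon>(1) unfolding continuous_within_eps_delta by force
  obtain d2 where d2: "d2 > 0" "\<And>z. z \<in> N e t \<Longrightarrow> dist z (b t, t) < d2 \<Longrightarrow>
      dist (case z of (y, s) \<Rightarrow> f\<^sub>t y s) (f\<^sub>t (b t) t) < \<epsilon>"
    using cont_t \<epsilon>(1) unfolding continuous_within_eps_delta by force
  obtain d3 where d3: "d3 > 0" "\<And>s. s \<noteq> t \<Longrightarrow> \<bar>s - t\<bar> < d3 \<Longrightarrow>
      \<bar>(b s - b t) / (s - t) - b'\<bar> < \<epsilon>"
    using b[unfolded has_field_derivative_iff, THEN LIM_D, OF \<epsilon>(1)] by auto
  have b_lin: "\<bar>b s - b t - b' * (s - t)\<bar> \<le> \<epsilon> * \<bar>s - t\<bar>" if "\<bar>s - t\<bar> < d3" for s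
  proof (cases "s = t")
    case False
    have "b s - b t - b' * (s - t) = ((b s - b t) / (s - t) - b') * (s - t)"
      using False by (simp add: field_simps)
    then have "\<bar>b s - b t - b' * (s - t)\<bar> = \<bar>(b s - b t) / (s - t) - b'\<bar> * \<bar>s - t\<bar>"
      by (simp only: abs_mult)
    also have "\<dots> \<le> \<epsilon> * \<bar>s - t\<bar>"
      using d3(2)[OF False that] by (intro mult_right_mono) auto
    finally show ?thesis .
  qed simp
  have b_lip: "\<bar>b s - b t\<bar> \<le> (k - 1 / 2) * \<bar>s - t\<bar>" if "\<bar>s - t\<bar> < d3" for s
  proof -
    have "\<bar>b s - b t\<bar> \<le> \<bar>b s - b t - b' * (s - t)\<bar> + \<bar>b' * (s - t)\<bar>" by linarith
    also have "\<dots> \<le> 1 / 2 * \<bar>s - t\<bar> + \<bar>b'\<bar> * \<bar>s - t\<bar>"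
      using b_lin[OF that] mult_right_mono[OF \<epsilon>(2), of "\<bar>s - t\<bar>"] by (simp add: abs_mult)
    also have "\<dots> = (k - 1 / 2) * \<bar>s - t\<bar>" by (simp add: k_def algebra_simps)
    finally show ?thesis .
  qed
  \<comment> \<open>The bound \<open>d3\<close> serves the linear approximation of \<open>b\<close>,
    \<open>e / k\<close> keeps \<open>m\<close> above \<open>b t - e\<close>, and the last term
    keeps the path, which stays within \<open>2 * k * \<bar>s - t\<bar>\<close> of its start, inside
    the continuity radii \<open>d1\<close> and \<open>d2\<close>.\<close>
  define d where "d = min (min d3 (e / k)) (min d1 d2 / (2 * k))"
  have "d > 0" using d1 d2 d3 k \<open>e > 0\<close> by (simp add: d_def)
  moreover have "\<bar>(f (b s) s - f (b t) t) / (s - t) - (f\<^sub>y (b t) t * b' + f\<^sub>t (b t) t)\<bar> < r"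
    if s: "s \<noteq> t" "\<bar>s - t\<bar> < d" for s
  proof -
    define h where "h = \<bar>s - t\<bar>"
    define m where "m = b t - k * h"
    have h: "h > 0" "h < d3" "k * h < e" "2 * (k * h) < d1" "2 * (k * h) < d2"
    proof -
      show "h > 0" "h < d3" using s by (auto simp: h_def d_def)
      have "h < e / k" "h < min d1 d2 / (2 * k)" using s by (auto simp: h_def d_def)
      then have "k * h < e" "2 * (k * h) < min d1 d2" using k by (auto simp: field_simps)
      then show "k * h < e" "2 * (k * h) < d1" "2 * (k * h) < d2" by auto
    qed
    have "h \<le> k * h" using k h by simp
    have "h \<le> 2 * (k * h)" "h < e" using \<open>h \<le> k * h\<close> h by linarith+
    have b_le: "\<bar>b \<tau> - b t\<bar> \<le> k * h - h / 2" if "\<bar>\<tau> - t\<bar> \<le> h" for \<tau>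
    proof -
      have "\<bar>b \<tau> - b t\<bar> \<le> (k - 1 / 2) * \<bar>\<tau> - t\<bar>" using b_lip[of \<tau>] that h by auto
      also have "\<dots> \<le> (k - 1 / 2) * h" using that k by (intro mult_left_mono) auto
      finally show ?thesis by (simp add: algebra_simps)
    qed
    \<comment> \<open>The margin \<open>h / 2\<close> puts \<open>m\<close> strictly below the curve
      throughout the middle piece, where \<open>f\<^sub>t\<close> is therefore available.\<close>
    have m_lt: "m < b \<tau>" if "\<bar>\<tau> - t\<bar> \<le> h" for \<tau>
      using b_le[OF that] h by (simp add: m_def abs_le_iff)
    have N: "(y, \<tau>) \<in> N e t" if "\<bar>\<tau> - t\<bar> \<le> h" "m \<le> y" "y \<le> b \<tau>" for y \<tau>
      using that h \<open>h < e\<close> unfolding N_def m_def by auto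
    have near: "dist (y, \<tau>) (b t, t) < d1" "dist (y, \<tau>) (b t, t) < d2"
      if "\<bar>\<tau> - t\<bar> \<le> h" "m \<le> y" "y \<le> b \<tau>" for y \<tau>
    proof -
      have "\<bar>y - b t\<bar> \<le> k * h" using that b_le[OF that(1)] h unfolding m_def by auto
      moreover have "dist (y, \<tau>) (b t, t) \<le> \<bar>y - b t\<bar> + \<bar>\<tau> - t\<bar>"
        by (simp add: dist_Pair_Pair dist_real_def sqrt_sum_squares_le_sum_abs)
      ultimately have "dist (y, \<tau>) (b t, t) \<le> 2 * (k * h)"
        using that(1) \<open>h \<le> k * h\<close> by linarith
      then show "dist (y, \<tau>) (b t, t) < d1" "dist (y, \<tau>) (b t, t) < d2"
        using h by auto
    qed
    have f_y_near: "\<bar>f\<^sub>y y \<tau> - f\<^sub>y (b t) t\<bar> \<le> \<epsilon>" if "\<bar>\<tau> - t\<bar> \<le> h" "m \<le> y" "y \<le> b \<tau>" for y \<tau>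
      using d1(2)[OF N near(1)] that by (fastforce simp: dist_real_def)
    have f_t_near: "\<bar>f\<^sub>t y \<tau> - f\<^sub>t (b t) t\<bar> \<le> \<epsilon>" if "\<bar>\<tau> - t\<bar> \<le> h" "m \<le> y" "y \<le> b \<tau>" for y \<tau>
      using d2(2)[OF N near(2)] that by (fastforce simp: dist_real_def)
    have slice: "\<exists>\<eta>. m \<le> \<eta> \<and> \<eta> \<le> b \<tau> \<and> f (b \<tau>) \<tau> - f m \<tau> = f\<^sub>y \<eta> \<tau> * (b \<tau> - m)"
      if \<tau>: "\<bar>\<tau> - t\<bar> \<le> h" for \<tau>
    proof -
      obtain \<eta> where "m < \<eta>" "\<eta> < b \<tau>" "f (b \<tau>) \<tau> - f m \<tau> = f\<^sub>y \<eta> \<tau> * (b \<tau> - m)"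
      proof (rule MVT_within[OF m_lt[OF \<tau>], where T = "{b t - e<..b \<tau>}" and f = "\<lambda>y. f y \<tau>" and f' = "\<lambda>y. f\<^sub>y y \<tau>"])
        show "{m..b \<tau>} \<subseteq> {b t - e<..b \<tau>}" using h by (auto simp: m_def)
      qed (use f_y N \<tau> in auto)
      then show ?thesis by (auto intro!: exI[of _ \<eta>])
    qed
    obtain \<eta> where \<eta>: "m \<le> \<eta>" "\<eta> \<le> b s" "f (b s) s - f m s = f\<^sub>y \<eta> s * (b s - m)"
      using slice[of s] by (auto simp: h_def)
    obtain \<zeta> where \<zeta>: "m \<le> \<zeta>" "\<zeta> \<le> b t" "f (b t) t - f m t = f\<^sub>y \<zeta> t * (b t - m)"
      using slice[of t] by (auto simp: h_def)
    have seg: "\<bar>\<tau> - t\<bar> \<le> h" if "\<tau> \<in> closed_segment t s" for \<tau>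
      using that by (auto simp: h_def closed_segment_eq_real_ivl split: if_splits)
    obtain \<theta> where \<theta>: "\<theta> \<in> closed_segment t s" "f m s - f m t = f\<^sub>t m \<theta> * (s - t)"
      by (rule MVT_segment[of t s "\<lambda>s. f m s" "\<lambda>s. f\<^sub>t m s"])
         (use f_t N seg m_lt in \<open>auto simp: less_imp_le\<close>)
    let ?p = "f\<^sub>y (b t) t" and ?g = "f\<^sub>t (b t) t"
    have triangle: "\<bar>x1 + x2 - x3 + x4\<bar> \<le> \<bar>x1\<bar> + \<bar>x2\<bar> + \<bar>x3\<bar> + \<bar>x4\<bar>" for x1 x2 x3 x4 :: real
      by linarith
    \<comment> \<open>The mean values multiply \<open>b s - m\<close> and \<open>b t - m\<close>;
      once \<open>?p\<close> is subtracted from both, the leftover multiples combine to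
      \<open>?p * (b s - b t)\<close>.\<close>
    have split: "f (b s) s - f (b t) t - (?p * b' + ?g) * (s - t) =
       (f\<^sub>y \<eta> s - ?p) * (b s - m) + (f\<^sub>t m \<theta> - ?g) * (s - t) - (f\<^sub>y \<zeta> t - ?p) * (b t - m)
         + ?p * (b s - b t - b' * (s - t))"
      using \<eta>(3) \<zeta>(3) \<theta>(2) by (simp add: algebra_simps)
    have "\<bar>f (b s) s - f (b t) t - (?p * b' + ?g) * (s - t)\<bar> \<le> \<bar>(f\<^sub>y \<eta> s - ?p) * (b s - m)\<bar> + \<bar>(f\<^sub>t m \<theta> - ?g) * (s - t)\<bar>
         + \<bar>(f\<^sub>y \<zeta> t - ?p) * (b t - m)\<bar> + \<bar>?p * (b s - b t - b' * (s - t))\<bar>"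
      unfolding split by (rule triangle)
    also have "\<dots> \<le> \<epsilon> * (2 * (k * h)) + \<epsilon> * h + \<epsilon> * (k * h) + \<bar>?p\<bar> * (\<epsilon> * h)"
      unfolding abs_mult
    proof (intro add_mono mult_mono)
      show "\<bar>b s - m\<bar> \<le> 2 * (k * h)"
        using b_le[of s] h(1) unfolding h_def[symmetric] m_def by linarith
      show "\<bar>b t - m\<bar> \<le> k * h" using h k by (simp add: m_def)
      show "\<bar>f\<^sub>y \<eta> s - ?p\<bar> \<le> \<epsilon>" using f_y_near[of s \<eta>] \<eta> by (simp add: h_def)
      show "\<bar>f\<^sub>y \<zeta> t - ?p\<bar> \<le> \<epsilon>" using f_y_near[of t \<zeta>] \<zeta> h by simp
      show "\<bar>f\<^sub>t m \<theta> - ?g\<bar> \<le> \<epsilon>"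
        using f_t_near[of \<theta> m] seg[OF \<theta>(1)] m_lt[of \<theta>] by simp
      show "\<bar>b s - b t - b' * (s - t)\<bar> \<le> \<epsilon> * h"
        using b_lin[of s] h by (simp add: h_def)
    qed (use \<epsilon> h k in \<open>auto simp: h_def\<close>)
    also have "\<dots> \<le> \<epsilon> * M * h"
      using \<epsilon>(1) h(1) by (simp add: M_def algebra_simps)
    also have "\<dots> < r * h" using \<epsilon>(3) h(1) by (intro mult_strict_right_mono)
    finally have "\<bar>f (b s) s - f (b t) t - (?p * b' + ?g) * (s - t)\<bar> < r * \<bar>s - t\<bar>"
      by (simp add: h_def)
    moreover have "f (b s) s - f (b t) t - (?p * b' + ?g) * (s - t)
      = ((f (b s) s - f (b t) t) / (s - t) - (?p * b' + ?g)) * (s - t)"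
      using s(1) by (simp add: field_simps)
    ultimately have "\<bar>(f (b s) s - f (b t) t) / (s - t) - (?p * b' + ?g)\<bar> * \<bar>s - t\<bar> < r * \<bar>s - t\<bar>"
      by (simp only: abs_mult)
    then show ?thesis by (rule mult_right_less_imp_less) simp
  qed
  ultimately show "\<exists>d>0. \<forall>s. s \<noteq> t \<and> norm (s - t) < d \<longrightarrow>
      norm ((f (b s) s - f (b t) t) / (s - t) - (f\<^sub>y (b t) t * b' + f\<^sub>t (b t) t)) < r"
    by auto
qed

text \<open>Extending \<open>F\<close> by its limit 0 makes it continuous on the closed interval, so
  the fundamental theorem with derivatives on the open interval applies. It handles integrals from
  time 0, where the region degenerates.\<close>

lemma has_integral_improper_FTC:
  fixes F f :: "real \<Rightarrow> real"
  assumes "t > 0" and lim: "(F \<longlongrightarrow> 0) (at_right 0)"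
    and F: "\<And>s. s > 0 \<Longrightarrow> (F has_real_derivative f s) (at s)"
  shows "(f has_integral F t) {0..t}"
proof -
  define G where "G = (\<lambda>s. if s \<le> 0 then 0 else F s)"
  have G: "(G has_real_derivative f s) (at s)" if "s > 0" for s
    by (rule DERIV_cong_ev[THEN iffD2, OF refl _ refl F[OF that]])
       (use that in \<open>auto simp: G_def eventually_nhds intro!: exI[of _ "{0<..}"]\<close>)
  have "(G \<longlongrightarrow> G 0) (at 0 within {0..t})"
  proof -
    have "\<forall>\<^sub>F s in at_right 0. F s = G s"
      by (auto simp: eventually_at_filter G_def)
    with lim have "(G \<longlongrightarrow> 0) (at_right 0)"
      by (rule Lim_transform_eventually)
    then show ?thesis
      using \<open>t > 0\<close> by (simp add: G_def at_within_Icc_at_right)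
  qed
  then have "continuous (at s within {0..t}) G" if "s \<in> {0..t}" for s
  proof (cases "s = 0")
    case False
    with that have "isCont G s" using G[of s] by (auto intro: DERIV_isCont)
    then show ?thesis by (rule continuous_at_imp_continuous_at_within)
  qed (simp add: continuous_within)
  then have "(f has_integral (G t - G 0)) {0..t}"
    using \<open>t > 0\<close> G
    by (intro fundamental_theorem_of_calculus_interior)
       (auto simp: continuous_on_eq_continuous_within has_real_derivative_iff_has_vector_derivative)
  then show ?thesis using \<open>t > 0\<close> by (simp add: G_def)
qed

section \<open>Classical solutions with nonvanishing space derivative\<close>

text \<open>The space derivatives are carried as named functions \<open>p\<close>, \<open>r\<close>,
  \<open>w\<close> with derivative facts, so that calculations can differentiate them directly
  instead of unfolding \<open>partial1\<close>.\<close>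

locale burgers_solution =
  fixes \<delta> :: real and S :: "real \<Rightarrow> real" and x p r w :: "real \<Rightarrow> real \<Rightarrow> real"
  assumes S_pos: "t > 0 \<Longrightarrow> 0 < S t"
    and S_deriv: "t > 0 \<Longrightarrow> (S has_real_derivative deriv S t) (at t)"
    and x_y: "0 < t \<Longrightarrow> 0 \<le> y \<Longrightarrow> y \<le> S t \<Longrightarrow>
      ((\<lambda>y. x y t) has_real_derivative p y t) (at y within {0..S t})"
    and p_y: "0 < t \<Longrightarrow> 0 \<le> y \<Longrightarrow> y \<le> S t \<Longrightarrow>
      ((\<lambda>y. p y t) has_real_derivative r y t) (at y within {0..S t})"
    and r_y: "0 < t \<Longrightarrow> 0 < y \<Longrightarrow> y < S t \<Longrightarrow> ((\<lambda>y. r y t) has_real_derivative w y t) (at y)"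
    and cont_x: "continuous_on {(y, t). 0 < t \<and> 0 \<le> y \<and> y \<le> S t} (\<lambda>(y, t). x y t)"
    and cont_p: "continuous_on {(y, t). 0 < t \<and> 0 \<le> y \<and> y \<le> S t} (\<lambda>(y, t). p y t)"
    and cont_r: "continuous_on {(y, t). 0 < t \<and> 0 \<le> y \<and> y \<le> S t} (\<lambda>(y, t). r y t)"
    and cont_w: "continuous_on {(y, t). 0 < t \<and> 0 < y \<and> y < S t} (\<lambda>(y, t). w y t)"
    and x_t: "0 < t \<Longrightarrow> 0 < y \<Longrightarrow> y < S t \<Longrightarrow>
      ((\<lambda>s. x y s) has_real_derivative r y t - 2 * \<delta> * x y t * p y t) (at t)"
    and p_nz: "0 < t \<Longrightarrow> 0 \<le> y \<Longrightarrow> y \<le> S t \<Longrightarrow> p y t \<noteq> 0"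
begin

abbreviation D where "D \<equiv> {(y, t). 0 < t \<and> 0 \<le> y \<and> y \<le> S t}"
abbreviation D\<^sub>0 where "D\<^sub>0 \<equiv> {(y, t). 0 < t \<and> 0 < y \<and> y < S t}"
abbreviation g where "g y t \<equiv> r y t - 2 * \<delta> * x y t * p y t"

lemma cont_g: "continuous_on D (\<lambda>(y, t). g y t)"
  using cont_x cont_p cont_r unfolding case_prod_beta by (intro continuous_intros)

lemma S_isCont: "t > 0 \<Longrightarrow> isCont S t"
  using S_deriv DERIV_isCont by blast

text \<open>Openness of the region in the form of a box, for arguments that vary space and time
  separately.\<close>

lemma D\<^sub>0_box:
  assumes "0 < t" "0 < y" "y < S t"
  obtains e where "e > 0" "\<And>z s. \<bar>z - y\<bar> < e \<Longrightarrow> \<bar>s - t\<bar> < e \<Longrightarrow> 0 < s \<and> 0 < z \<and> z < S s"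
proof -
  \<comment> \<open>The gap between \<open>y\<close> and \<open>S t\<close> is shared:
    \<open>z\<close> rises by less than half of it and \<open>S s\<close> drops by less than
    half.\<close>
  obtain d where d: "d > 0" "\<And>s. \<bar>s - t\<bar> < d \<Longrightarrow> \<bar>S s - S t\<bar> < (S t - y) / 2"
    using S_isCont[OF assms(1)] assms(3) unfolding continuous_at_eps_delta
    by (force simp: dist_real_def dest: spec[of _ "(S t - y) / 2"])
  show thesis
  proof (rule that[of "min (min d t) (min y ((S t - y) / 2))"])
    show "0 < min (min d t) (min y ((S t - y) / 2))" using assms d by simp
    fix z s assume "\<bar>z - y\<bar> < min (min d t) (min y ((S t - y) / 2))"
      "\<bar>s - t\<bar> < min (min d t) (min y ((S t - y) / 2))"
    then have zs: "\<bar>z - y\<bar> < y" "\<bar>z - y\<bar> < (S t - y) / 2" "\<bar>s - t\<bar> < t" "\<bar>s - t\<bar> < d"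
      by (simp_all only: min_less_iff_conj)
    have "0 < s" "0 < z" using zs by linarith+
    moreover have "z - y < (S t - y) / 2" "S t - S s < (S t - y) / 2"
      using zs(2) d(2)[OF zs(4)] by (auto simp only: abs_less_iff minus_diff_eq)
    then have "z < S s" by (simp add: field_simps)
    ultimately show "0 < s \<and> 0 < z \<and> z < S s" by blast
  qed
qed

lemma D\<^sub>0_open: "open D\<^sub>0"
proof (rule open_dist[THEN iffD2], clarify)
  fix y t assume *: "0 < t" "0 < y" "y < S t"
  obtain e where e: "e > 0" "\<And>z s. \<bar>z - y\<bar> < e \<Longrightarrow> \<bar>s - t\<bar> < e \<Longrightarrow> 0 < s \<and> 0 < z \<and> z < S s"
    using D\<^sub>0_box[OF *] by metis
  have "\<bar>z - y\<bar> < e \<and> \<bar>s - t\<bar> < e" if "dist (z, s) (y, t) < e" for z s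
    using that dist_fst_le[of "(z, s)" "(y, t)"] dist_snd_le[of "(z, s)" "(y, t)"]
    by (simp add: dist_real_def)
  with e show "\<exists>e>0. \<forall>z. dist z (y, t) < e \<longrightarrow> z \<in> D\<^sub>0" by blast
qed

lemma isCont_D:
  assumes "continuous_on D f" "0 < t" "0 < y" "y < S t"
  shows "isCont f (y, t)"
proof -
  have "continuous_on D\<^sub>0 f" by (rule continuous_on_subset[OF assms(1)]) auto
  then show ?thesis using D\<^sub>0_open assms(2-) by (simp add: continuous_on_eq_continuous_at)
qed

lemma interior_slice:
  assumes "0 < y" "y < S t" "(f has_real_derivative f') (at y within {0..S t})"
  shows "(f has_real_derivative f') (at y)"
  using assms by (simp add: at_within_Icc_at)

section \<open>Time derivatives on the lateral boundaries\<close>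

text \<open>Near \<open>(S t, t)\<close> the closed region is what lies to the left of the curve
  \<open>y = S s\<close>, so the derivative along a curve applies with \<open>b = S\<close>.\<close>

lemma has_real_derivative_at_right_boundary:
  assumes "t > 0"
    and f_y: "\<And>y s. (y, s) \<in> D \<Longrightarrow> ((\<lambda>y. f y s) has_real_derivative f\<^sub>y y s) (at y within {0..S s})"
    and f_t: "\<And>y s. (y, s) \<in> D\<^sub>0 \<Longrightarrow> ((\<lambda>s. f y s) has_real_derivative f\<^sub>t y s) (at s)"
    and cont: "continuous_on D (\<lambda>(y, t). f\<^sub>y y t)" "continuous_on D (\<lambda>(y, t). f\<^sub>t y t)"
  shows "((\<lambda>s. f (S s) s) has_real_derivative f\<^sub>y (S t) t * deriv S t + f\<^sub>t (S t) t) (at t)"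
proof -
  \<comment> \<open>This size forces \<open>s > 0\<close> and \<open>y > 0\<close>, so the one-sided
    neighbourhood stays in \<open>D\<close>.\<close>
  define e where "e = min t (S t)"
  let ?N = "{(y, s). \<bar>s - t\<bar> < e \<and> S t - e < y \<and> y \<le> S s}"
  have e: "e > 0" using assms(1) S_pos by (simp add: e_def)
  have N: "?N \<subseteq> D" by (auto simp: e_def)
  have cont': "continuous (at (S t, t) within ?N) F" if "continuous_on D F" for F :: "real \<times> real \<Rightarrow> real"
    using continuous_on_subset[OF that N] e unfolding continuous_on_eq_continuous_within by auto
  show ?thesis
  proof (rule has_real_derivative_along_boundary[OF S_deriv[OF \<open>t > 0\<close>] e])
    fix y s assume ys: "(y, s) \<in> ?N"
    then have "(y, s) \<in> D" using N by blast
    moreover have "{S t - e<..S s} \<subseteq> {0..S s}" by (auto simp: e_def)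
    ultimately show "((\<lambda>y. f y s) has_real_derivative f\<^sub>y y s) (at y within {S t - e<..S s})"
      using f_y DERIV_subset by blast
    show "((\<lambda>s. f y s) has_real_derivative f\<^sub>t y s) (at s)" if "y < S s"
      using ys that by (intro f_t) (auto simp: e_def)
  qed (auto intro: cont' cont)
qed

text \<open>Reflecting \<open>y\<close> to \<open>- y\<close> moves the region to the left of the
  constant curve at 0, whose slope 0 removes the contribution of \<open>f\<^sub>y\<close>.\<close>

lemma has_real_derivative_at_left_boundary:
  assumes "t > 0"
    and f_y: "\<And>y s. (y, s) \<in> D \<Longrightarrow> ((\<lambda>y. f y s) has_real_derivative f\<^sub>y y s) (at y within {0..S s})"
    and f_t: "\<And>y s. (y, s) \<in> D\<^sub>0 \<Longrightarrow> ((\<lambda>s. f y s) has_real_derivative f\<^sub>t y s) (at s)"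
    and cont: "continuous_on D (\<lambda>(y, t). f\<^sub>y y t)" "continuous_on D (\<lambda>(y, t). f\<^sub>t y t)"
  shows "((\<lambda>s. f 0 s) has_real_derivative f\<^sub>t 0 t) (at t)"
proof -
  have "0 < S t / 2" "S t / 2 < S t" using S_pos[OF \<open>t > 0\<close>] by auto
  \<comment> \<open>The box around the midpoint keeps \<open>S s\<close> above
    \<open>S t / 2\<close> for all times near \<open>t\<close>, which is the room needed to the
    right of the boundary.\<close>
  then obtain e0 where e0: "e0 > 0"
    "\<And>z s. \<bar>z - S t / 2\<bar> < e0 \<Longrightarrow> \<bar>s - t\<bar> < e0 \<Longrightarrow> 0 < s \<and> 0 < z \<and> z < S s"
    using D\<^sub>0_box[OF \<open>t > 0\<close>] by metis
  define e where "e = min e0 (S t / 2)"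
  let ?N = "{(y, s). \<bar>s - t\<bar> < e \<and> 0 - e < y \<and> y \<le> 0}"
  have e: "e > 0" using e0 S_pos[OF \<open>t > 0\<close>] by (simp add: e_def)
  have box: "0 < s \<and> -y < S s" if "(y, s) \<in> ?N" for y s
    using that e0(2)[of "S t / 2" s] e0(1) by (auto simp: e_def)
  have pt: "(0, t) \<in> ?N" using e by auto
  have cont': "continuous (at (0, t) within ?N) (\<lambda>(y, s). F (- y) s)"
    if "continuous_on D (\<lambda>(y, t). F y t)" for F :: "real \<Rightarrow> real \<Rightarrow> real"
  proof -
    have "continuous_on ?N (\<lambda>z. (\<lambda>(y, t). F y t) (- fst z, snd z))"
      using box by (intro continuous_on_compose2[OF that] continuous_intros) force+
    then have "continuous_on ?N (\<lambda>(y, s). F (- y) s)"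
      by (simp add: case_prod_beta)
    then show ?thesis using pt by (simp add: continuous_on_eq_continuous_within)
  qed
  have "((\<lambda>s. f (- 0) s) has_real_derivative (- f\<^sub>y (- 0) t) * 0 + f\<^sub>t (- 0) t) (at t)"
  proof (rule has_real_derivative_along_boundary[where f = "\<lambda>y s. f (- y) s" and b = "\<lambda>_. 0"
        and f\<^sub>y = "\<lambda>y s. - f\<^sub>y (- y) s" and f\<^sub>t = "\<lambda>y s. f\<^sub>t (- y) s", OF _ e])
    fix y s assume ys: "(y, s) \<in> ?N"
    have "(-y, s) \<in> D" using box[OF ys] ys by auto
    moreover have "uminus ` {0 - e<..0} \<subseteq> {0..S s}"
    proof
      fix z assume "z \<in> uminus ` {0 - e<..0}"
      then show "z \<in> {0..S s}" using box[of "- z" s] ys by auto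
    qed
    ultimately have "((\<lambda>y. f y s) has_real_derivative f\<^sub>y (- y) s)
        (at (- y) within uminus ` {0 - e<..0})"
      by (rule DERIV_subset[OF f_y])
    moreover have "(uminus has_real_derivative - 1) (at y within {0 - e<..0})"
      by (auto intro!: derivative_eq_intros)
    ultimately have "(((\<lambda>y. f y s) \<circ> uminus) has_real_derivative f\<^sub>y (- y) s * - 1)
        (at y within {0 - e<..0})"
      by (rule DERIV_image_chain)
    then show "((\<lambda>y. f (- y) s) has_real_derivative - f\<^sub>y (- y) s) (at y within {0 - e<..0})"
      by (simp add: o_def)
    show "((\<lambda>s. f (- y) s) has_real_derivative f\<^sub>t (- y) s) (at s)" if "y < 0"
      using box[OF ys] that by (intro f_t) auto
  next
    show "continuous (at (0, t) within ?N) (\<lambda>(y, s). - f\<^sub>y (- y) s)"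
      using continuous_minus[OF cont'[OF cont(1)]] by (simp add: case_prod_unfold)
    show "continuous (at (0, t) within ?N) (\<lambda>(y, s). f\<^sub>t (- y) s)"
      by (rule cont'[OF cont(2)])
  qed simp
  then show ?thesis by simp
qed

lemma left_trace_deriv:
  "t > 0 \<Longrightarrow> ((\<lambda>s. x 0 s) has_real_derivative g 0 t) (at t)"
  by (rule has_real_derivative_at_left_boundary[OF _ _ _ cont_p cont_g]) (auto intro: x_y x_t)

lemma right_trace_deriv:
  "t > 0 \<Longrightarrow> ((\<lambda>s. x (S s) s) has_real_derivative p (S t) t * deriv S t + g (S t) t) (at t)"
  by (rule has_real_derivative_at_right_boundary[OF _ _ _ cont_p cont_g]) (auto intro: x_y x_t)

section \<open>Mixed derivatives, space slices and level curves\<close>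

text \<open>Symmetry of the mixed partial derivatives: the value is the space derivative of
  \<open>g\<close>, the time derivative of \<open>x\<close>.\<close>

lemma p_t:
  assumes "0 < t" "0 < y" "y < S t"
  shows "((\<lambda>s. p y s) has_real_derivative w y t - 2 * \<delta> * ((p y t)\<^sup>2 + x y t * r y t)) (at t)"
proof -
  obtain e where e: "e > 0" "\<And>z s. \<bar>z - y\<bar> < e \<Longrightarrow> \<bar>s - t\<bar> < e \<Longrightarrow> 0 < s \<and> 0 < z \<and> z < S s"
    using D\<^sub>0_box[OF assms] by metis
  have w: "isCont (\<lambda>(y, t). w y t) (y, t)"
    using cont_w D\<^sub>0_open assms by (simp add: continuous_on_eq_continuous_at)
  show ?thesis
  proof (rule has_real_derivative_mixed_partial[OF e(1), where f = x and g = g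
      and f\<^sub>y\<^sub>t = "\<lambda>y t. w y t - 2 * \<delta> * ((p y t)\<^sup>2 + x y t * r y t)"])
    fix z s assume zs: "\<bar>z - y\<bar> < e" "\<bar>s - t\<bar> < e"
    note in_D = e(2)[OF zs]
    show "((\<lambda>s. x z s) has_real_derivative g z s) (at s)" using x_t in_D by blast
    have xy: "((\<lambda>z. x z s) has_real_derivative p z s) (at z)"
      using in_D by (intro interior_slice[OF _ _ x_y]) auto
    have py: "((\<lambda>z. p z s) has_real_derivative r z s) (at z)"
      using in_D by (intro interior_slice[OF _ _ p_y]) auto
    show "((\<lambda>z. g z s) has_real_derivative w z s - 2 * \<delta> * ((p z s)\<^sup>2 + x z s * r z s)) (at z)"
      using in_D
      by (auto intro!: derivative_eq_intros xy py r_y simp: algebra_simps power2_eq_square)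
  next
    fix s assume "\<bar>s - t\<bar> < e"
    then show "((\<lambda>z. x z s) has_real_derivative p y s) (at y)"
      using e(2)[of y s] e(1) by (intro interior_slice[OF _ _ x_y]) auto
  next
    show "isCont (\<lambda>(y, t). w y t - 2 * \<delta> * ((p y t)\<^sup>2 + x y t * r y t)) (y, t)"
      using isCont_D[OF cont_x assms] isCont_D[OF cont_p assms] isCont_D[OF cont_r assms] w
      unfolding case_prod_beta by (intro continuous_intros)
  qed
qed

lemma x_slice_cont: "t > 0 \<Longrightarrow> continuous_on {0..S t} (\<lambda>y. x y t)"
  by (rule DERIV_continuous_on[where D = "\<lambda>y. p y t"]) (auto intro: x_y)

text \<open>By the mean value theorem, equal values at two points would force a zero of
  \<open>p\<close> between them.\<close>

lemma x_slice_inj: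
  assumes "t > 0"
  shows "inj_on (\<lambda>y. x y t) {0..S t}"
proof (rule linorder_inj_onI')
  fix a b assume ab: "a \<in> {0..S t}" "b \<in> {0..S t}" "a < b"
  obtain z where "a < z" "z < b" "x b t - x a t = p z t * (b - a)"
    by (rule MVT_within[OF ab(3), of "\<lambda>y. x y t" "\<lambda>y. p y t" "{0..S t}"])
       (use ab assms x_y in auto)
  then show "x a t \<noteq> x b t" using p_nz[of t z] ab assms by auto
qed

text \<open>The segment has no orientation, which suits the situation: the sign of \<open>p\<close>,
  and with it the order of the two end values, is left open.\<close>

lemma x_slice_image:
  assumes "t > 0"
  shows "(\<lambda>y. x y t) ` {0..S t} = closed_segment (x 0 t) (x (S t) t)"
  using continuous_injective_image_segment_1[of 0 "S t" "\<lambda>y. x y t"]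
    x_slice_cont[OF assms] x_slice_inj[OF assms] S_pos[OF assms]
  by (simp add: closed_segment_eq_real_ivl)

lemma traces_neq: "t > 0 \<Longrightarrow> x 0 t \<noteq> x (S t) t"
  using inj_onD[OF x_slice_inj, of t 0 "S t"] S_pos[of t] by auto

text \<open>An implicit function argument: the signs of \<open>x - \<xi>\<close> at two points on
  either side of \<open>y\<close> persist for nearby times, so the intermediate value theorem traps
  \<open>Y s\<close> between them. This gives existence and continuity; the mean value theorem on
  slices then gives the derivative.\<close>

lemma level_curve:
  assumes ty: "0 < t" "0 < y" "y < S t"
  obtains Y where "Y t = y"
    "\<forall>\<^sub>F s in nhds t. 0 < Y s \<and> Y s < S s \<and> x (Y s) s = x y t"
    "(Y has_real_derivative - g y t / p y t) (at t)"
proof -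
  define \<xi> where "\<xi> = x y t"
  define Y where "Y s = (THE z. z \<in> {0..S s} \<and> x z s = \<xi>)" for s
  have Y_eq: "Y s = z" if "s > 0" "z \<in> {0..S s}" "x z s = \<xi>" for s z
    unfolding Y_def using that inj_onD[OF x_slice_inj[OF that(1)]] by (intro the_equality) auto
  have Yt: "Y t = y" using ty by (intro Y_eq) (auto simp: \<xi>_def)
  have x_tendsto: "((\<lambda>s. x a s) \<longlongrightarrow> x a t) (nhds t)" if "0 < a" "a < S t" for a
    using DERIV_isCont[OF x_t[OF ty(1) that]] by (simp add: isCont_def tendsto_at_iff_tendsto_nhds)
  have in_D0: "\<forall>\<^sub>F s in nhds t. 0 < s \<and> a < S s" if a: "0 < a" "a < S t" for a
  proof -
    obtain e where e: "e > 0" "\<And>z s. \<bar>z - a\<bar> < e \<Longrightarrow> \<bar>s - t\<bar> < e \<Longrightarrow> 0 < s \<and> 0 < z \<and> z < S s"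
      using D\<^sub>0_box[OF ty(1) a] by metis
    then show ?thesis
      unfolding eventually_nhds_metric dist_real_def by (metis abs_zero diff_self)
  qed
  have bracket: "\<forall>\<^sub>F s in nhds t. s > 0 \<and> b < S s \<and> a < Y s \<and> Y s < b \<and> x (Y s) s = \<xi>"
    if ab: "0 < a" "a < y" "y < b" "b < S t" for a b
  proof -
    have "inj_on (\<lambda>y. x y t) {a..b}"
      by (rule inj_on_subset[OF x_slice_inj[OF ty(1)]]) (use ab in auto)
    moreover have "continuous_on {a..b} (\<lambda>y. x y t)"
      by (rule continuous_on_subset[OF x_slice_cont[OF ty(1)]]) (use ab in auto)
    \<comment> \<open>Either sign of \<open>p\<close> may occur, so the level \<open>\<xi>\<close>
      is crossed upwards or downwards.\<close>
    ultimately consider "x a t < \<xi>" "\<xi> < x b t" | "x b t < \<xi>" "\<xi> < x a t"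
      using continuous_inj_imp_mono[of a y b "\<lambda>y. x y t"] ab unfolding \<xi>_def by auto
    then have "\<forall>\<^sub>F s in nhds t. (x a s < \<xi> \<and> \<xi> < x b s) \<or> (x b s < \<xi> \<and> \<xi> < x a s)"
    proof cases
      case 1
      then have "\<forall>\<^sub>F s in nhds t. x a s < \<xi>" "\<forall>\<^sub>F s in nhds t. \<xi> < x b s"
        using order_tendstoD x_tendsto[of a] x_tendsto[of b] ab by force+
      then show ?thesis by eventually_elim auto
    next
      case 2
      then have "\<forall>\<^sub>F s in nhds t. x b s < \<xi>" "\<forall>\<^sub>F s in nhds t. \<xi> < x a s"
        using order_tendstoD x_tendsto[of a] x_tendsto[of b] ab by force+
      then show ?thesis by eventually_elim auto
    qed
    moreover have "\<forall>\<^sub>F s in nhds t. 0 < s \<and> b < S s" using in_D0[of b] ab by auto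
    ultimately show ?thesis
    proof eventually_elim
      case (elim s)
      have cont: "continuous_on {a..b} (\<lambda>y. x y s)"
        by (rule continuous_on_subset[OF x_slice_cont]) (use ab elim in auto)
      have "\<exists>z\<ge>a. z \<le> b \<and> x z s = \<xi>"
        using elim(1) IVT'[of "\<lambda>y. x y s" a \<xi> b, OF _ _ _ cont]
          IVT2'[of "\<lambda>y. x y s" b \<xi> a, OF _ _ _ cont] ab by auto
      then obtain z where z: "a \<le> z" "z \<le> b" "x z s = \<xi>" by blast
      then have "Y s = z" using elim ab by (intro Y_eq) auto
      moreover have "z \<noteq> a" "z \<noteq> b" using z elim by auto
      ultimately show ?case using z elim by auto
    qed
  qed
  have "0 < y / 2" "y / 2 < y" "y < (y + S t) / 2" "(y + S t) / 2 < S t" using ty by auto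
  from bracket[OF this]
  have Y_level: "\<forall>\<^sub>F s in nhds t. 0 < s \<and> 0 < Y s \<and> Y s < S s \<and> x (Y s) s = \<xi>"
    by eventually_elim (use ty in auto)
  have Y_lim: "(Y \<longlongrightarrow> y) (nhds t)"
  proof (rule tendstoI)
    fix e :: real assume "e > 0"
    define a where "a = max (y / 2) (y - e)"
    define b where "b = min ((y + S t) / 2) (y + e)"
    have "0 < a" "a < y" "y < b" "b < S t" using ty \<open>e > 0\<close> by (auto simp: a_def b_def min_less_iff_disj)
    from bracket[OF this] show "\<forall>\<^sub>F s in nhds t. dist (Y s) y < e"
      by eventually_elim (auto simp: a_def b_def dist_real_def)
  qed
  have in_D: "\<forall>\<^sub>F s in nhds t. 0 < s \<and> y < S s" using in_D0[of y] ty by auto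
  \<comment> \<open>On the slice at time \<open>s\<close>, the level equation becomes linear in
    \<open>Y s - y\<close>, with slope \<open>p\<close> at an intermediate point. That point is
    squeezed to \<open>y\<close>, so the slope tends to \<open>p y t\<close>, and the difference
    quotient of \<open>Y\<close> is minus that of \<open>x\<close> over the slope.\<close>
  have "\<forall>\<^sub>F s in nhds t. \<exists>\<eta>. \<bar>\<eta> - y\<bar> \<le> \<bar>Y s - y\<bar> \<and> p \<eta> s \<noteq> 0 \<and>
          \<xi> - x y s = p \<eta> s * (Y s - y)"
    using Y_level in_D
  proof eventually_elim
    case (elim s)
    have sub: "z \<in> closed_segment y (Y s) \<Longrightarrow> 0 < z \<and> z < S s" for z
      using elim ty by (auto simp: closed_segment_eq_real_ivl split: if_splits)
    obtain \<eta> where \<eta>: "\<eta> \<in> closed_segment y (Y s)" "x (Y s) s - x y s = p \<eta> s * (Y s - y)"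
      using MVT_segment[of y "Y s" "\<lambda>y. x y s" "\<lambda>y. p y s"] sub elim
        interior_slice[OF _ _ x_y] by (metis less_imp_le)
    then show ?case
      using sub[OF \<eta>(1)] elim p_nz[of s \<eta>]
      by (intro exI[of _ \<eta>]) (auto simp: closed_segment_eq_real_ivl split: if_splits)
  qed
  then obtain \<eta> where \<eta>: "\<forall>\<^sub>F s in nhds t. \<bar>\<eta> s - y\<bar> \<le> \<bar>Y s - y\<bar> \<and> p (\<eta> s) s \<noteq> 0 \<and>
          \<xi> - x y s = p (\<eta> s) s * (Y s - y)"
    unfolding eventually_ex by blast
  have "((\<lambda>s. \<eta> s - y) \<longlongrightarrow> 0) (nhds t)"
  proof (rule Lim_null_comparison)
    show "\<forall>\<^sub>F s in nhds t. norm (\<eta> s - y) \<le> \<bar>Y s - y\<bar>" using \<eta> by eventually_elim auto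
    show "((\<lambda>s. \<bar>Y s - y\<bar>) \<longlongrightarrow> 0) (nhds t)"
      using Y_lim by (auto intro!: tendsto_eq_intros)
  qed
  then have "((\<lambda>s. (\<eta> s, s)) \<longlongrightarrow> (y, t)) (nhds t)"
    by (intro tendsto_Pair) (simp_all add: LIM_zero_iff filterlim_ident)
  from isCont_tendsto_compose[OF isCont_D[OF cont_p ty] this]
  have "((\<lambda>s. p (\<eta> s) s) \<longlongrightarrow> p y t) (at t)"
    using tendsto_mono[OF at_within_le_nhds] by force
  moreover have "((\<lambda>s. (x y s - x y t) / (s - t)) \<longlongrightarrow> g y t) (at t)"
    using x_t[OF ty] by (simp add: has_field_derivative_iff)
  ultimately have "((\<lambda>s. - ((x y s - x y t) / (s - t)) / p (\<eta> s) s) \<longlongrightarrow> - g y t / p y t) (at t)"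
    using p_nz[of t y] ty by (intro tendsto_intros) auto
  moreover have "\<forall>\<^sub>F s in at t. - ((x y s - x y t) / (s - t)) / p (\<eta> s) s = (Y s - Y t) / (s - t)"
    unfolding eventually_at_filter using \<eta>
  proof eventually_elim
    case (elim s)
    then have "- (x y s - x y t) = p (\<eta> s) s * (Y s - Y t)" by (simp add: Yt \<xi>_def)
    then have "- (x y s - x y t) / p (\<eta> s) s = Y s - Y t" using elim by simp
    moreover have "- ((x y s - x y t) / (s - t)) / p (\<eta> s) s
        = (- (x y s - x y t) / p (\<eta> s) s) / (s - t)"
      by (simp only: minus_divide_left divide_divide_eq_left mult.commute)
    ultimately show ?case by simp
  qed
  ultimately have "(Y has_real_derivative - g y t / p y t) (at t)"
    unfolding has_field_derivative_iff by (rule Lim_transform_eventually)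
  moreover have "\<forall>\<^sub>F s in nhds t. 0 < Y s \<and> Y s < S s \<and> x (Y s) s = x y t"
    using Y_level by eventually_elim (auto simp: \<xi>_def)
  ultimately show thesis using that Yt by blast
qed

text \<open>A chain rule for \<open>p\<close>: the interior curve \<open>Y\<close> takes the role of
  the boundary in the derivative along a curve.\<close>

lemma p_along_curve_deriv:
  assumes ty: "0 < t" "0 < Y t" "Y t < S t" and Y: "(Y has_real_derivative Y') (at t)"
  shows "((\<lambda>s. p (Y s) s) has_real_derivative
    r (Y t) t * Y' + (w (Y t) t - 2 * \<delta> * ((p (Y t) t)\<^sup>2 + x (Y t) t * r (Y t) t))) (at t)"
proof -
  obtain e0 where e0: "e0 > 0"
    "\<And>z s. \<bar>z - Y t\<bar> < e0 \<Longrightarrow> \<bar>s - t\<bar> < e0 \<Longrightarrow> 0 < s \<and> 0 < z \<and> z < S s"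
    using D\<^sub>0_box[OF ty] by metis
  obtain d where d: "d > 0" "\<And>s. \<bar>s - t\<bar> < d \<Longrightarrow> \<bar>Y s - Y t\<bar> < e0"
    using DERIV_isCont[OF Y] e0(1) unfolding continuous_at_eps_delta by (force simp: dist_real_def)
  define e where "e = min d e0"
  have e: "e > 0" using d e0 by (simp add: e_def)
  let ?N = "{(y, s). \<bar>s - t\<bar> < e \<and> Y t - e < y \<and> y \<le> Y s}"
  have N: "0 < s \<and> 0 < y \<and> y < S s" if "(y, s) \<in> ?N" for y s
    using that d(2)[of s] e0(2)[of y s] by (auto simp: e_def)
  have w: "isCont (\<lambda>(y, t). w y t) (Y t, t)"
    using cont_w D\<^sub>0_open ty by (simp add: continuous_on_eq_continuous_at)
  show ?thesis
  proof (rule has_real_derivative_along_boundary[OF Y e, where f = p and f\<^sub>y = r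
      and f\<^sub>t = "\<lambda>y t. w y t - 2 * \<delta> * ((p y t)\<^sup>2 + x y t * r y t)"])
    fix y s assume "(y, s) \<in> ?N"
    note in_D = N[OF this]
    show "((\<lambda>y. p y s) has_real_derivative r y s) (at y within {Y t - e<..Y s})"
      using in_D by (intro has_field_derivative_at_within[OF interior_slice[OF _ _ p_y]]) auto
    show "((\<lambda>s. p y s) has_real_derivative w y s - 2 * \<delta> * ((p y s)\<^sup>2 + x y s * r y s)) (at s)"
      using in_D p_t by blast
  next
    show "continuous (at (Y t, t) within ?N) (\<lambda>(y, s). r y s)"
      by (rule continuous_at_imp_continuous_at_within[OF isCont_D[OF cont_r ty]])
    show "continuous (at (Y t, t) within ?N)
        (\<lambda>(y, t). w y t - 2 * \<delta> * ((p y t)\<^sup>2 + x y t * r y t))"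
      using isCont_D[OF cont_x ty] isCont_D[OF cont_p ty] isCont_D[OF cont_r ty] w
      unfolding case_prod_beta
      by (intro continuous_at_imp_continuous_at_within[OF continuous_diff] continuous_intros)
  qed
qed

section \<open>Time derivative of the space integral\<close>

text \<open>The integral from 0 to \<open>y\<close> is treated as a function of \<open>y\<close> and
  time: its space derivative is \<open>x\<close>, and its time derivative is the integral of
  \<open>g\<close>, a difference of values of \<open>p - \<delta> x^2\<close>. The right boundary
  lemma then moves the upper limit to \<open>S\<close>.\<close>

lemma integral_deriv:
  assumes "t > 0"
  shows "((\<lambda>s. integral {0..S s} (\<lambda>\<sigma>. x \<sigma> s)) has_real_derivative
    x (S t) t * deriv S t + (p (S t) t - \<delta> * (x (S t) t)\<^sup>2) - (p 0 t - \<delta> * (x 0 t)\<^sup>2)) (at t)"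
proof -
  \<comment> \<open>\<open>J\<close> is the primitive of \<open>g\<close> in space that vanishes at
    \<open>y = 0\<close>.\<close>
  define J where "J y t = p y t - \<delta> * (x y t)\<^sup>2 - (p 0 t - \<delta> * (x 0 t)\<^sup>2)" for y t
  have J: "((\<lambda>y. J y t) has_real_derivative g y t) (at y within {0..S t})"
    if "(y, t) \<in> D" for y t
  proof -
    have xy: "((\<lambda>y. x y t) has_real_derivative p y t) (at y within {0..S t})"
      and py: "((\<lambda>y. p y t) has_real_derivative r y t) (at y within {0..S t})"
      using that x_y p_y by auto
    show ?thesis unfolding J_def by (auto intro!: derivative_eq_intros xy py)
  qed
  have "((\<lambda>s. integral {0..S s} (\<lambda>\<sigma>. x \<sigma> s)) has_real_derivative x (S t) t * deriv S t + J (S t) t) (at t)"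
  proof (rule has_real_derivative_at_right_boundary[OF assms, where f = "\<lambda>y s. integral {0..y} (\<lambda>\<sigma>. x \<sigma> s)"])
    fix y s assume ys: "(y, s) \<in> D"
    then show "((\<lambda>y. integral {0..y} (\<lambda>\<sigma>. x \<sigma> s)) has_real_derivative x y s) (at y within {0..S s})"
      by (intro integral_has_real_derivative x_slice_cont) auto
  next
    fix y t assume yt: "(y, t) \<in> D\<^sub>0"
    then obtain e where e: "e > 0"
      "\<And>z s. \<bar>z - y\<bar> < e \<Longrightarrow> \<bar>s - t\<bar> < e \<Longrightarrow> 0 < s \<and> 0 < z \<and> z < S s"
      using D\<^sub>0_box[of t y] by auto
    define U where "U = {t - e<..<t + e}"
    have U: "0 < s \<and> y < S s" if "s \<in> U" for s
      using e(2)[of y s] e(1) that by (auto simp: U_def)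
    have "((\<lambda>s. integral (cbox 0 y) (\<lambda>\<sigma>. x \<sigma> s)) has_real_derivative
            integral (cbox 0 y) (\<lambda>\<sigma>. g \<sigma> t)) (at t within U)"
    proof (rule leibniz_rule_field_derivative)
      \<comment> \<open>At \<open>\<sigma> = 0\<close> the time derivative is that of the left
        trace; the other endpoint \<open>y\<close> lies strictly left of \<open>S s\<close> for
        every \<open>s\<close> in \<open>U\<close>.\<close>
      fix s \<sigma> assume s: "s \<in> U" and \<sigma>: "\<sigma> \<in> cbox 0 y"
      then show "((\<lambda>s. x \<sigma> s) has_real_derivative g \<sigma> s) (at s within U)"
        using U[OF s] left_trace_deriv[of s] x_t[of s \<sigma>]
        by (cases "\<sigma> = 0") (auto intro: has_field_derivative_at_within)
    next
      fix s assume "s \<in> U"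
      then show "(\<lambda>\<sigma>. x \<sigma> s) integrable_on cbox 0 y"
        using U by (intro integrable_continuous continuous_on_subset[OF x_slice_cont]) force+
    next
      have "continuous_on (U \<times> cbox 0 y) (\<lambda>z. (\<lambda>(y, t). g y t) (snd z, fst z))"
        by (intro continuous_on_compose2[OF cont_g] continuous_intros) (use U in force)
      then show "continuous_on (U \<times> cbox 0 y) (\<lambda>(s, \<sigma>). g \<sigma> s)" by (simp add: case_prod_beta)
    qed (use e in \<open>auto simp: U_def\<close>)
    moreover have "at t within U = at t"
      by (rule at_within_open) (use e in \<open>auto simp: U_def\<close>)
    moreover have "((\<lambda>\<sigma>. g \<sigma> t) has_integral (J y t - J 0 t)) {0..y}"
    proof (rule fundamental_theorem_of_calculus)
      fix z assume "z \<in> {0..y}"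
      then show "((\<lambda>y. J y t) has_vector_derivative g z t) (at z within {0..y})"
        unfolding has_real_derivative_iff_has_vector_derivative[symmetric]
        using yt by (intro DERIV_subset[OF J]) auto
    qed (use yt in auto)
    ultimately show "((\<lambda>s. integral {0..y} (\<lambda>\<sigma>. x \<sigma> s)) has_real_derivative J y t) (at t)"
      by (simp add: integral_unique J_def)
  next
    show "continuous_on D (\<lambda>(y, t). x y t)" by (rule cont_x)
    \<comment> \<open>\<open>J\<close> contains boundary values at 0, which depend on time only and
      are regarded here as functions on \<open>D\<close>.\<close>
    have trace: "continuous_on D (\<lambda>z. F 0 (snd z))" if "continuous_on D (\<lambda>(y, t). F y t)"
      for F :: "real \<Rightarrow> real \<Rightarrow> real"
    proof -
      have "continuous_on D (\<lambda>z. (\<lambda>(y, t). F y t) (0, snd z))"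
        by (intro continuous_on_compose2[OF that] continuous_intros) auto
      then show ?thesis by simp
    qed
    show "continuous_on D (\<lambda>(y, t). J y t)"
      using cont_x cont_p trace[OF cont_x] trace[OF cont_p]
      unfolding J_def case_prod_beta by (intro continuous_intros)
  qed
  then show ?thesis by (simp add: J_def algebra_simps)
qed

section \<open>Derivatives of the reciprocal function\<close>

context
  fixes \<Psi> :: "real \<Rightarrow> real \<Rightarrow> real"
  assumes \<Psi>: "\<And>y t. t > 0 \<Longrightarrow> 0 \<le> y \<Longrightarrow> y \<le> S t \<Longrightarrow> \<Psi> (x y t) t = 1 / p y t"
begin

text \<open>In the variable \<open>y\<close>, \<open>\<Psi>\<close> is \<open>1 / p\<close>; its
  \<open>y\<close>-derivative is divided by \<open>p\<close>, the derivative of the change of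
  variable.\<close>

lemma reciprocal_has_space_derivative:
  assumes "0 < t" "0 \<le> y" "y \<le> S t"
  shows "((\<lambda>\<xi>. \<Psi> \<xi> t) has_real_derivative - (r y t / p y t ^ 3))
    (at (x y t) within closed_segment (x 0 t) (x (S t) t))"
proof -
  have "((\<lambda>y. 1 / p y t) has_real_derivative - (r y t / (p y t)\<^sup>2)) (at y within {0..S t})"
    using p_nz[OF assms]
    by (auto intro!: derivative_eq_intros p_y[OF assms] simp: power2_eq_square)
  from has_real_derivative_of_comp_inj_on[OF compact_Icc x_slice_cont x_slice_inj _ x_y p_nz this,
      of "\<lambda>\<xi>. \<Psi> \<xi> t"]
  have "((\<lambda>\<xi>. \<Psi> \<xi> t) has_real_derivative - (r y t / (p y t)\<^sup>2) / p y t)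
      (at (x y t) within (\<lambda>y. x y t) ` {0..S t})"
    using assms \<Psi> by auto
  then show ?thesis
    using assms by (simp add: x_slice_image power3_eq_cube power2_eq_square)
qed

text \<open>The two end values differ, so the derivative relative to the segment is unique and
  \<open>partial1\<close> picks it.\<close>

lemma reciprocal_partial1:
  assumes "0 < t" "0 \<le> y" "y \<le> S t"
  shows "partial1 (\<lambda>t. closed_segment (x 0 t) (x (S t) t)) \<Psi> (x y t) t = - (r y t / p y t ^ 3)"
proof -
  let ?a = "min (x 0 t) (x (S t) t)" and ?b = "max (x 0 t) (x (S t) t)"
  have seg: "closed_segment (x 0 t) (x (S t) t) = {?a..?b}"
    by (auto simp: closed_segment_eq_real_ivl)
  have "?a < ?b" using traces_neq[OF assms(1)] by auto
  moreover have "x y t \<in> {?a..?b}"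
    unfolding seg[symmetric] x_slice_image[OF assms(1), symmetric] using assms by auto
  ultimately show ?thesis
    using reciprocal_has_space_derivative[OF assms]
    unfolding partial1_def seg has_real_derivative_iff_has_vector_derivative
    by (rule vector_derivative_within_closed_interval)
qed

text \<open>In the variable \<open>y\<close> the flux is \<open>- r / p\<close>, whose
  \<open>y\<close>-derivative is divided by \<open>p\<close>.\<close>

lemma reciprocal_flux_deriv:
  assumes ty: "0 < t" "0 < y" "y < S t"
    and \<Psi>_x: "\<Psi>_x = partial1 (\<lambda>t. closed_segment (x 0 t) (x (S t) t)) \<Psi>"
  shows "((\<lambda>\<xi>. \<Psi>_x \<xi> t / (\<Psi> \<xi> t)\<^sup>2) has_real_derivative
    (r y t)\<^sup>2 / p y t ^ 3 - w y t / (p y t)\<^sup>2) (at (x y t))"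
proof -
  have ty': "0 \<le> y" "y \<le> S t" using ty by auto
  note nz = p_nz[OF ty(1) ty']
  have "((\<lambda>y. - r y t / p y t) has_real_derivative (r y t)\<^sup>2 / (p y t)\<^sup>2 - w y t / p y t)
      (at y within {0..S t})"
    using nz
    by (auto intro!: derivative_eq_intros p_y[OF ty(1) ty'] has_field_derivative_at_within[OF r_y[OF ty]]
        simp: field_simps power2_eq_square)
  from has_real_derivative_of_comp_inj_on[OF compact_Icc x_slice_cont x_slice_inj _ x_y p_nz this,
      of "\<lambda>\<xi>. \<Psi>_x \<xi> t / (\<Psi> \<xi> t)\<^sup>2"]
  have "((\<lambda>\<xi>. \<Psi>_x \<xi> t / (\<Psi> \<xi> t)\<^sup>2) has_real_derivative
      ((r y t)\<^sup>2 / (p y t)\<^sup>2 - w y t / p y t) / p y t) (at (x y t) within (\<lambda>y. x y t) ` {0..S t})"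
    using ty ty' \<Psi> p_nz by (auto simp: \<Psi>_x reciprocal_partial1 power3_eq_cube power2_eq_square)
  \<comment> \<open>By injectivity an interior \<open>y\<close> gives an interior point of the
    segment, where the relative derivative is the ordinary one.\<close>
  moreover have "at (x y t) within (\<lambda>y. x y t) ` {0..S t} = at (x y t)"
  proof -
    have "x y t \<noteq> x 0 t" "x y t \<noteq> x (S t) t"
      using inj_onD[OF x_slice_inj[OF ty(1)], of y 0] inj_onD[OF x_slice_inj[OF ty(1)], of y "S t"] ty
      by auto
    moreover have "x y t \<in> closed_segment (x 0 t) (x (S t) t)"
      unfolding x_slice_image[OF ty(1), symmetric] using ty by auto
    ultimately show ?thesis
      unfolding x_slice_image[OF ty(1)]
      by (intro at_within_interior) (auto simp: closed_segment_eq_real_ivl split: if_splits)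
  qed
  moreover have "((r y t)\<^sup>2 / (p y t)\<^sup>2 - w y t / p y t) / p y t
      = (r y t)\<^sup>2 / p y t ^ 3 - w y t / (p y t)\<^sup>2"
    by (simp add: diff_divide_distrib power3_eq_cube power2_eq_square)
  ultimately show ?thesis by simp
qed

text \<open>Holding the first argument of \<open>\<Psi>\<close> fixed means following the level
  curve \<open>Y\<close>, along which \<open>\<Psi>\<close> is \<open>1 / p (Y s) s\<close>.\<close>

lemma reciprocal_time_deriv:
  assumes ty: "0 < t" "0 < y" "y < S t"
  shows "((\<lambda>s. \<Psi> (x y t) s) has_real_derivative
    (r y t)\<^sup>2 / p y t ^ 3 - w y t / (p y t)\<^sup>2 + 2 * \<delta>) (at t)"
proof -
  obtain Y where Y: "Y t = y"
    and ev: "\<forall>\<^sub>F s in nhds t. 0 < Y s \<and> Y s < S s \<and> x (Y s) s = x y t"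
    and Y': "(Y has_real_derivative - g y t / p y t) (at t)"
    by (rule level_curve[OF ty])
  have nz: "p y t \<noteq> 0" using p_nz ty by auto
  have p_Y: "((\<lambda>s. p (Y s) s) has_real_derivative
    r y t * (- g y t / p y t) + (w y t - 2 * \<delta> * ((p y t)\<^sup>2 + x y t * r y t))) (at t)"
    using p_along_curve_deriv[OF ty(1) _ _ Y'] ty by (simp add: Y)
  \<comment> \<open>The terms in \<open>x * r\<close> cancel, and
    \<open>- 2 * \<delta> * p^2\<close> divided by \<open>- p^2\<close> leaves the constant
    \<open>2 * \<delta>\<close>.\<close>
  have reciprocal: "((\<lambda>s. 1 / p (Y s) s) has_real_derivative
     (r y t)\<^sup>2 / p y t ^ 3 - w y t / (p y t)\<^sup>2 + 2 * \<delta>) (at t)"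
    using nz by (auto intro!: derivative_eq_intros p_Y
        simp: Y field_simps power2_eq_square power3_eq_cube)
  have "\<forall>\<^sub>F s in nhds t. \<Psi> (x y t) s = 1 / p (Y s) s"
  proof -
    have "\<forall>\<^sub>F s in nhds t. s > 0" using eventually_nhds_in_open[of "{0<..}" t] ty(1) by simp
    with ev show ?thesis
    proof eventually_elim
      case (elim s)
      then show ?case using \<Psi>[of s "Y s"] by auto
    qed
  qed
  from DERIV_cong_ev[OF refl this refl] reciprocal show ?thesis by (rule iffD2)
qed

end

end

section \<open>The reciprocal problem with its boundary conditions and moving boundaries\<close>

theorem theorem3p1:
  fixes \<delta> q :: real
    and L T\<^sub>m S C X\<^sub>0 X\<^sub>1 V H :: "real \<Rightarrow> real"
    and x \<Psi> \<Psi>_x :: "real \<Rightarrow> real \<Rightarrow> real"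
  assumes "\<delta> > 0" and "q > 0"
    and L_nz: "\<And>t. t > 0 \<Longrightarrow> L t \<noteq> 0"
    and sol: "burgers_mbp_solution \<delta> q L T\<^sub>m x S C"
    and x_y_nz: "\<And>y t. t > 0 \<Longrightarrow> 0 \<le> y \<Longrightarrow> y \<le> S t \<Longrightarrow> partial1 (\<lambda>t. {0..S t}) x y t \<noteq> 0"
    and \<Psi>: "\<And>y t. t > 0 \<Longrightarrow> 0 \<le> y \<Longrightarrow> y \<le> S t \<Longrightarrow>
               \<Psi> (x y t) t = 1 / partial1 (\<lambda>t. {0..S t}) x y t"
    and X\<^sub>0: "X\<^sub>0 = (\<lambda>t. x 0 t)"
    and X\<^sub>1: "X\<^sub>1 = (\<lambda>t. x (S t) t)"
    and \<Psi>_x: "\<Psi>_x = partial1 (\<lambda>t. closed_segment (X\<^sub>0 t) (X\<^sub>1 t)) \<Psi>"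
    and V: "V = (\<lambda>t. \<Psi> (X\<^sub>1 t) t * deriv X\<^sub>1 t + \<Psi>_x (X\<^sub>1 t) t / (\<Psi> (X\<^sub>1 t) t)\<^sup>2 + 2 * \<delta> * X\<^sub>1 t)"
    and H: "H = (\<lambda>t. - ((T\<^sub>m t) ^ 3) / (L t * (C t)\<^sup>2)
                 + \<delta> * (T\<^sub>m t / L t) * (1 / \<Psi> (X\<^sub>1 t) t)
                 - \<delta> / \<Psi> (X\<^sub>1 t) t
                 + (T\<^sub>m t)\<^sup>2 / (C t)\<^sup>2
                 + \<delta> / \<Psi> (X\<^sub>0 t) t
                 - \<delta>\<^sup>2 * (X\<^sub>0 t)\<^sup>2)"
  shows
    \<comment> \<open>the reciprocal equation, with existence of the derivatives occurring in it and in (i)--(iii)\<close>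
    "(\<forall>t>0. (\<lambda>\<xi>. \<Psi> \<xi> t) differentiable_on closed_segment (X\<^sub>0 t) (X\<^sub>1 t)) \<and>
     (\<forall>t>0. \<forall>\<xi>. (X\<^sub>0 t < \<xi> \<and> \<xi> < X\<^sub>1 t) \<or> (X\<^sub>1 t < \<xi> \<and> \<xi> < X\<^sub>0 t) \<longrightarrow>
        (\<lambda>\<zeta>. \<Psi>_x \<zeta> t / (\<Psi> \<zeta> t)\<^sup>2) differentiable (at \<xi>) \<and>
        ((\<lambda>s. \<Psi> \<xi> s) has_real_derivative
           deriv (\<lambda>\<zeta>. \<Psi>_x \<zeta> t / (\<Psi> \<zeta> t)\<^sup>2) \<xi> + 2 * \<delta>) (at t)) \<and>
     (\<forall>t>0. X\<^sub>1 differentiable (at t)) \<and>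
     \<comment> \<open>(i)\<close>
     (\<forall>t>0. 1 / \<Psi> (X\<^sub>1 t) t - \<delta> * (X\<^sub>1 t)\<^sup>2 = - (L t / (\<delta> * C t)) * V t) \<and>
     \<comment> \<open>(ii); the improper integral from 0 presupposes the initial behaviour in the premise\<close>
     (((\<lambda>t. integral {0..S t} (\<lambda>\<sigma>. x \<sigma> t)) \<longlongrightarrow> 0) (at_right 0) \<longrightarrow>
        (\<forall>t>0. H integrable_on {0..t} \<and>
           1 / \<Psi> (X\<^sub>0 t) t - \<delta> * (X\<^sub>0 t)\<^sup>2 = - q * exp (integral {0..t} H) / (\<delta> * C t))) \<and>
     \<comment> \<open>(iii)\<close>
     (\<forall>t>0. (C has_real_derivative (L t - T\<^sub>m t) * V t) (at t)) \<and>
     \<comment> \<open>the moving boundaries; likewise, the formula for the left one presupposes a zero initial value\<close>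
     ((X\<^sub>0 \<longlongrightarrow> 0) (at_right 0) \<longrightarrow>
        (\<forall>t>0. (\<lambda>\<tau>. \<Psi>_x (X\<^sub>0 \<tau>) \<tau> / (\<Psi> (X\<^sub>0 \<tau>) \<tau>) ^ 3 + 2 * \<delta> * (X\<^sub>0 \<tau> / \<Psi> (X\<^sub>0 \<tau>) \<tau>))
                 integrable_on {0..t} \<and>
           X\<^sub>0 t = - integral {0..t}
             (\<lambda>\<tau>. \<Psi>_x (X\<^sub>0 \<tau>) \<tau> / (\<Psi> (X\<^sub>0 \<tau>) \<tau>) ^ 3 + 2 * \<delta> * (X\<^sub>0 \<tau> / \<Psi> (X\<^sub>0 \<tau>) \<tau>)))) \<and>
     (\<forall>t>0. X\<^sub>1 t = T\<^sub>m t / (\<delta> * C t))"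
proof -
  define p where "p = partial1 (\<lambda>t. {0..S t}) x"
  define r where "r = partial1 (\<lambda>t. {0..S t}) p"
  define w where "w = partial1 (\<lambda>t. {0..S t}) r"
  have S: "\<forall>t>0. 0 < S t \<and> S differentiable (at t)"
    and x_diff: "\<forall>t>0. (\<lambda>y. x y t) differentiable_on {0..S t}"
    and p_diff: "\<forall>t>0. (\<lambda>y. p y t) differentiable_on {0..S t}"
    and r_diff: "\<forall>t>0. (\<lambda>y. r y t) differentiable_on {0<..<S t}"
    and cont: "continuous_on {(y, t). 0 < t \<and> 0 \<le> y \<and> y \<le> S t} (\<lambda>(y, t). x y t)"
      "continuous_on {(y, t). 0 < t \<and> 0 \<le> y \<and> y \<le> S t} (\<lambda>(y, t). p y t)"
      "continuous_on {(y, t). 0 < t \<and> 0 \<le> y \<and> y \<le> S t} (\<lambda>(y, t). r y t)"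
      "continuous_on {(y, t). 0 < t \<and> 0 < y \<and> y < S t} (\<lambda>(y, t). w y t)"
    and pde: "\<forall>t>0. \<forall>y. 0 < y \<and> y < S t \<longrightarrow>
       ((\<lambda>s. x y s) has_real_derivative r y t - 2 * \<delta> * x y t * p y t) (at t)"
    and C_pos: "\<forall>t>0. 0 < C t"
    and C_t: "\<forall>t>0. (C has_real_derivative (L t - T\<^sub>m t) * deriv S t) (at t)"
    and bc1: "\<forall>t>0. p (S t) t - \<delta> * (x (S t) t)\<^sup>2 = - (L t * deriv S t) / (\<delta> * C t)"
    and bc2: "\<forall>t>0. x (S t) t = T\<^sub>m t / (\<delta> * C t)"
    and bc3: "\<forall>t>0. p 0 t - \<delta> * (x 0 t)\<^sup>2 =
       - q * exp (\<delta> * (- integral {0..S t} (\<lambda>\<sigma>. x \<sigma> t))) / (\<delta> * C t)"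
    using sol[unfolded burgers_mbp_solution_def classical_regularity_def Let_def,
      folded p_def, folded r_def, folded w_def]
    by - (elim conjE, assumption)+
  have partial1_deriv: "((\<lambda>y. f y t) has_real_derivative partial1 (\<lambda>t. {0..S t}) f y t) (at y within {0..S t})"
    if "(\<lambda>y. f y t) differentiable_on {0..S t}" "0 \<le> y" "y \<le> S t"
    for f :: "real \<Rightarrow> real \<Rightarrow> real" and y t
    using that unfolding partial1_def has_real_derivative_iff_has_vector_derivative
    by (simp add: differentiable_on_def vector_derivative_works)
  interpret burgers_solution \<delta> S x p r w
  proof
    fix y t :: real assume t: "0 < t"
    show "0 < S t" using S t by simp
    show "(S has_real_derivative deriv S t) (at t)"
      using S t by (simp add: DERIV_deriv_iff_real_differentiable)
    {
      assume y: "0 \<le> y" "y \<le> S t"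
      show "((\<lambda>y. x y t) has_real_derivative p y t) (at y within {0..S t})"
        unfolding p_def using x_diff t y by (intro partial1_deriv) auto
      show "((\<lambda>y. p y t) has_real_derivative r y t) (at y within {0..S t})"
        unfolding r_def using p_diff t y by (intro partial1_deriv) auto
      show "p y t \<noteq> 0" using x_y_nz t y by (simp add: p_def)
    }
    assume y: "0 < y" "y < S t"
    have "(\<lambda>y. r y t) differentiable (at y)"
      using r_diff t y by (auto simp: differentiable_on_eq_differentiable_at)
    then show "((\<lambda>y. r y t) has_real_derivative w y t) (at y)"
      using y unfolding w_def partial1_def has_real_derivative_iff_has_vector_derivative
      by (simp add: at_within_Icc_at vector_derivative_works)
    show "((\<lambda>s. x y s) has_real_derivative r y t - 2 * \<delta> * x y t * p y t) (at t)"
      using pde t y by simp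
  qed (rule cont)+
  note C_pos = C_pos[rule_format] and C_t = C_t[rule_format]
    and bc1 = bc1[rule_format] and bc2 = bc2[rule_format] and bc3 = bc3[rule_format]
  have \<Psi>': "\<Psi> (x y t) t = 1 / p y t" if "t > 0" "0 \<le> y" "y \<le> S t" for y t
    using \<Psi>[OF that] by (simp add: p_def)
  have \<Psi>_x': "\<Psi>_x = partial1 (\<lambda>t. closed_segment (x 0 t) (x (S t) t)) \<Psi>"
    by (simp add: \<Psi>_x X\<^sub>0 X\<^sub>1)
  have \<Psi>_x_eq: "\<Psi>_x (x y t) t = - (r y t / p y t ^ 3)" if "t > 0" "0 \<le> y" "y \<le> S t" for y t
    using reciprocal_partial1[OF \<Psi>' that] by (simp add: \<Psi>_x')
  have ends: "0 \<le> S t" "p 0 t \<noteq> 0" "p (S t) t \<noteq> 0" "\<Psi> (X\<^sub>0 t) t = 1 / p 0 t"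
      "\<Psi> (X\<^sub>1 t) t = 1 / p (S t) t" "\<Psi>_x (X\<^sub>0 t) t = - (r 0 t / p 0 t ^ 3)"
      "\<Psi>_x (X\<^sub>1 t) t = - (r (S t) t / p (S t) t ^ 3)" if "t > 0" for t
    using S_pos[OF that] that by (auto simp: X\<^sub>0 X\<^sub>1 \<Psi>' \<Psi>_x_eq p_nz)
  have X\<^sub>1_deriv: "(X\<^sub>1 has_real_derivative p (S t) t * deriv S t + g (S t) t) (at t)" if "t > 0" for t
    using right_trace_deriv[OF that] by (simp add: X\<^sub>1)
  \<comment> \<open>At the right boundary \<open>\<Psi>_x / \<Psi>^2\<close> is
    \<open>- r / p\<close>, which together with \<open>2 * \<delta> * x\<close> cancels
    \<open>g / p\<close>.\<close>
  have V_eq: "V t = deriv S t" if "t > 0" for t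
  proof -
    have "V t = 1 / p (S t) t * (p (S t) t * deriv S t + g (S t) t)
        + - (r (S t) t / p (S t) t ^ 3) / (1 / p (S t) t)\<^sup>2 + 2 * \<delta> * X\<^sub>1 t"
      by (simp only: V ends(5,7)[OF that] DERIV_imp_deriv[OF X\<^sub>1_deriv[OF that]])
    also have "\<dots> = deriv S t"
      using ends(3)[OF that] by (simp add: X\<^sub>1 field_simps power2_eq_square power3_eq_cube)
    finally show ?thesis .
  qed
  show ?thesis
  proof (intro conjI allI impI)
    fix t :: real assume t: "t > 0"
    have "(\<lambda>\<xi>. \<Psi> \<xi> t) differentiable (at \<xi> within closed_segment (x 0 t) (x (S t) t))"
      if \<xi>: "\<xi> \<in> closed_segment (x 0 t) (x (S t) t)" for \<xi>
    proof -
      obtain y where "\<xi> = x y t" "0 \<le> y" "y \<le> S t"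
        using \<xi> unfolding x_slice_image[OF t, symmetric] by auto
      then show ?thesis
        using reciprocal_has_space_derivative[OF \<Psi>' t] real_differentiable_def by blast
    qed
    then show "(\<lambda>\<xi>. \<Psi> \<xi> t) differentiable_on closed_segment (X\<^sub>0 t) (X\<^sub>1 t)"
      by (simp add: differentiable_on_def X\<^sub>0 X\<^sub>1)
  next
    fix t \<xi> :: real
    assume t: "t > 0" and \<xi>: "(X\<^sub>0 t < \<xi> \<and> \<xi> < X\<^sub>1 t) \<or> (X\<^sub>1 t < \<xi> \<and> \<xi> < X\<^sub>0 t)"
    then have "\<xi> \<in> closed_segment (x 0 t) (x (S t) t)"
      by (auto simp: X\<^sub>0 X\<^sub>1 closed_segment_eq_real_ivl)
    then obtain y where y: "\<xi> = x y t" "0 \<le> y" "y \<le> S t"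
      unfolding x_slice_image[OF t, symmetric] by auto
    then have "y \<noteq> 0" "y \<noteq> S t" using \<xi> by (auto simp: X\<^sub>0 X\<^sub>1)
    with y have y': "0 < y" "y < S t" by auto
    note flux = reciprocal_flux_deriv[OF \<Psi>' t y' \<Psi>_x']
    show "(\<lambda>\<zeta>. \<Psi>_x \<zeta> t / (\<Psi> \<zeta> t)\<^sup>2) differentiable (at \<xi>)"
      using flux real_differentiable_def unfolding y by blast
    show "((\<lambda>s. \<Psi> \<xi> s) has_real_derivative deriv (\<lambda>\<zeta>. \<Psi>_x \<zeta> t / (\<Psi> \<zeta> t)\<^sup>2) \<xi> + 2 * \<delta>) (at t)"
      using reciprocal_time_deriv[OF \<Psi>' t y'] DERIV_imp_deriv[OF flux] unfolding y by simp
  next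
    fix t :: real assume t: "t > 0"
    show "X\<^sub>1 differentiable (at t)"
      using X\<^sub>1_deriv[OF t] real_differentiable_def by blast
    show "1 / \<Psi> (X\<^sub>1 t) t - \<delta> * (X\<^sub>1 t)\<^sup>2 = - (L t / (\<delta> * C t)) * V t"
      using bc1[OF t] ends[OF t] by (simp add: V_eq[OF t] X\<^sub>1)
    show "(C has_real_derivative (L t - T\<^sub>m t) * V t) (at t)"
      using C_t[OF t] by (simp add: V_eq[OF t])
    show "X\<^sub>1 t = T\<^sub>m t / (\<delta> * C t)" using bc2[OF t] by (simp add: X\<^sub>1)
  next
    fix t :: real
    assume lim: "((\<lambda>t. integral {0..S t} (\<lambda>\<sigma>. x \<sigma> t)) \<longlongrightarrow> 0) (at_right 0)" and t: "t > 0"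
    \<comment> \<open>\<open>E\<close> is the exponent in the condition at \<open>y = 0\<close>. Its
      derivative is \<open>H\<close>, and the premise makes it vanish at time 0, so it is the
      integral of \<open>H\<close>.\<close>
    define E where "E = (\<lambda>t. \<delta> * (- integral {0..S t} (\<lambda>\<sigma>. x \<sigma> t)))"
    have E: "(E has_real_derivative H s) (at s)" if s: "s > 0" for s
    proof -
      define a b where "a = p (S s) s" and "b = deriv S s"
      \<comment> \<open>The flux condition at \<open>y = S\<close> is solved for the boundary speed,
        dividing by \<open>L s\<close>; this brings \<open>L\<close> into the denominators of
        \<open>H\<close>.\<close>
      have b: "b = - (\<delta> * C s / L s) * (a - \<delta> * (T\<^sub>m s / (\<delta> * C s))\<^sup>2)"
        using bc1[OF s] bc2[OF s] L_nz[OF s] C_pos[OF s] \<open>\<delta> > 0\<close>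
        by (simp add: a_def b_def field_simps)
      have "H s = - (T\<^sub>m s ^ 3) / (L s * (C s)\<^sup>2) + \<delta> * (T\<^sub>m s / L s) * a - \<delta> * a
          + (T\<^sub>m s)\<^sup>2 / (C s)\<^sup>2 + \<delta> * p 0 s - \<delta>\<^sup>2 * (x 0 s)\<^sup>2"
        unfolding H ends(4,5)[OF s] a_def by (simp add: X\<^sub>0)
      also have "\<dots> = - \<delta> * (T\<^sub>m s / (\<delta> * C s) * b + (a - \<delta> * (T\<^sub>m s / (\<delta> * C s))\<^sup>2)
            - (p 0 s - \<delta> * (x 0 s)\<^sup>2))"
        unfolding b using L_nz[OF s] C_pos[OF s] \<open>\<delta> > 0\<close>
        by (simp add: field_simps power2_eq_square power3_eq_cube)
      finally have "H s = \<dots>" .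
      moreover have "(E has_real_derivative - \<delta> * (T\<^sub>m s / (\<delta> * C s) * b
           + (a - \<delta> * (T\<^sub>m s / (\<delta> * C s))\<^sup>2) - (p 0 s - \<delta> * (x 0 s)\<^sup>2))) (at s)"
        using DERIV_cmult[OF integral_deriv[OF s], of "- \<delta>"]
        by (simp add: E_def a_def b_def bc2[OF s])
      ultimately show ?thesis by simp
    qed
    have "(E \<longlongrightarrow> 0) (at_right 0)"
      using lim unfolding E_def by (auto intro!: tendsto_eq_intros)
    then have "(H has_integral E t) {0..t}" by (rule has_integral_improper_FTC[OF t _ E])
    then show "H integrable_on {0..t}"
      and "1 / \<Psi> (X\<^sub>0 t) t - \<delta> * (X\<^sub>0 t)\<^sup>2 = - q * exp (integral {0..t} H) / (\<delta> * C t)"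
      using bc3[OF t] ends[OF t] by (auto simp: X\<^sub>0 E_def integral_unique)
  next
    fix t :: real
    assume lim: "(X\<^sub>0 \<longlongrightarrow> 0) (at_right 0)" and t: "t > 0"
    let ?h = "\<lambda>\<tau>. \<Psi>_x (X\<^sub>0 \<tau>) \<tau> / (\<Psi> (X\<^sub>0 \<tau>) \<tau>) ^ 3 + 2 * \<delta> * (X\<^sub>0 \<tau> / \<Psi> (X\<^sub>0 \<tau>) \<tau>)"
    have deriv: "((\<lambda>s. - X\<^sub>0 s) has_real_derivative ?h s) (at s)" if s: "s > 0" for s
    proof -
      \<comment> \<open>At \<open>y = 0\<close>, \<open>\<Psi>_x / \<Psi>^3\<close> is
        \<open>- r\<close> and \<open>X\<^sub>0 / \<Psi>\<close> is \<open>x * p\<close>.\<close>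
      have "?h s = - g 0 s"
        using ends[OF s] by (simp add: power3_eq_cube) (simp add: X\<^sub>0)
      then show ?thesis
        using DERIV_minus[OF left_trace_deriv[OF s]] by (simp add: X\<^sub>0)
    qed
    have "((\<lambda>s. - X\<^sub>0 s) \<longlongrightarrow> 0) (at_right 0)"
      using tendsto_minus[OF lim] by simp
    then have "(?h has_integral - X\<^sub>0 t) {0..t}"
      by (rule has_integral_improper_FTC[OF t _ deriv])
    then show "?h integrable_on {0..t}" "X\<^sub>0 t = - integral {0..t} ?h"
      by (auto simp: integral_unique)
  qed
qed

end
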